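(* Let $K$ be an algebraically closed field with characteristic exponent $p$, and let $m,n,r$ be natural numbers with $m,n \geq r$. Let $x=(x_{ij})$ be the $m\times n$ matrix of variables, regarded as coordinates on $K^{m\times n}$. Then there exists no nonzero polynomial $f\in K[x_{ij} \mid i\in[m],j\in[n]]$ with fewer than $(r+1)!$ terms that vanishes on all matrices of rank $r$ in $K^{m\times n}$. Moreover, if $r\geq 2$, then every polynomial with exactly $(r+1)!$ terms that vanishes on all rank-$r$ matrices in $K^{m\times n}$ is of the form $c\,u\cdot D^{p^e}$, where $c\in K^*$, $u$ is a monomial, $D$ is some $(r+1)\times(r+1)$-minor of $x$, and $e$ is a nonnegative integer.
   Context: The characteristic exponent $p$ of $K$ is $1$ if $\operatorname{char}K=0$ and $\operatorname{char}K$ otherwise. The number of terms of a polynomial is the number of monomials appearing in it with nonzero coefficient (with respect to the monomial basis). A "term" means a nonzero scalar times a monomial. *)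

theory Defs
  imports "HOL-Library.Poly_Mapping" "HOL-Combinatorics.Permutations"
    "HOL-Computational_Algebra.Polynomial" "Jordan_Normal_Form.DL_Rank"
begin

text \<open>Polynomials in the variables x_(i,j): finitely supported maps from monomials
  (finitely supported exponent maps on variable indices (i,j)) to coefficients.\<close>
type_synonym 'a xpoly = "((nat \<times> nat) \<Rightarrow>\<^sub>0 nat) \<Rightarrow>\<^sub>0 'a"

definition mvar :: "nat \<Rightarrow> nat \<Rightarrow> 'a::comm_ring_1 xpoly" where
  "mvar i j = Poly_Mapping.single (Poly_Mapping.single (i, j) 1) 1"

definition in_vars :: "nat \<Rightarrow> nat \<Rightarrow> 'a::zero xpoly \<Rightarrow> bool" where
  "in_vars m n f \<longleftrightarrow> (\<forall>mo\<in>Poly_Mapping.keys f. \<forall>v\<in>Poly_Mapping.keys mo. fst v < m \<and> snd v < n)"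

definition mpoly_eval :: "'a::comm_ring_1 xpoly \<Rightarrow> 'a mat \<Rightarrow> 'a" where
  "mpoly_eval f A = (\<Sum>mo\<in>Poly_Mapping.keys f. Poly_Mapping.lookup f mo * (\<Prod>v\<in>Poly_Mapping.keys mo. (A $$ v) ^ Poly_Mapping.lookup mo v))"

definition num_terms :: "'a::zero xpoly \<Rightarrow> nat" where
  "num_terms f = card (Poly_Mapping.keys f)"

definition minor_poly :: "nat list \<Rightarrow> nat list \<Rightarrow> 'a::comm_ring_1 xpoly" where
  "minor_poly is js = (\<Sum>\<pi> \<in> {\<pi>. \<pi> permutes {..<length is}}.
      of_int (sign \<pi>) * (\<Prod>k<length is. mvar (is ! k) (js ! \<pi> k)))"

definition char_exp :: "'a::semiring_1 itself \<Rightarrow> nat" where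
  "char_exp t = (if semiring_char t = 0 then 1 else semiring_char t)"

text \<open>Rank of a matrix with m rows (JNF: dimension of column span).\<close>
definition mrank :: "nat \<Rightarrow> 'a::field mat \<Rightarrow> nat" where
  "mrank m A = vec_space.rank m A"

end

theory Submission
  imports Defs "Jordan_Normal_Form.DL_Rank_Submatrix"
begin

text \<open>
  A polynomial is handled as a finite family of exponent matrices \<open>\<mu> s\<close> with coefficients \<open>c s\<close>;
  it vanishes on rank at most \<open>r\<close> iff it vanishes on all products \<open>B C\<close> with inner dimension \<open>r\<close>.
  Group the terms by their monomial \<open>a\<close> in the variables of one row \<open>i\<close>. Replacing that row by an
  arbitrary one shows that each part vanishes on rank \<open>r - 1\<close>. If only \<open>r\<close> monomials \<open>a\<close> occur,
  each part even vanishes on rank \<open>r\<close>: otherwise these \<open>r\<close> monomials would satisfy a linear relation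
  on every choice of \<open>r\<close> rows of \<open>C\<close>. Induction gives \<open>(r + 1) r!\<close> terms.

  With exactly \<open>(r + 1)!\<close> terms, the \<open>r + 1\<close> monomials of a row satisfy a relation on every
  \<open>r\<close>-dimensional space, so any three of them satisfy one at \<open>y\<close>, \<open>z\<close> and \<open>y + z\<close> for all \<open>y\<close>, \<open>z\<close>.
  Special values show that they are \<open>u \<cdot> x\<^sub>j ^ d\<close> with \<open>(1 + t) ^ d = 1 + t ^ d\<close>, so \<open>d = p ^ e\<close>.
  Applied to rows and columns, this makes every term a common monomial times the \<open>d\<close>-th power of a
  permutation. Evaluating at 0-1 matrices given by colourings of rows and columns with \<open>r\<close> colours
  shows that only \<open>r + 1\<close> rows are permuted, and that the coefficients alternate in sign.
\<close>

section \<open>Polynomial functions and independence of monomials\<close>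

text \<open>The pairs \<open>B\<close>, \<open>C\<close> range over an affine space, where a product
  of two polynomial functions vanishes identically only if one factor does. This replaces the
  irreducibility of the determinantal variety. It is needed because the coefficients in a relation
  between row monomials depend on the other rows: cancellation turns "some coefficient is not
  identically zero" into "the matrix of monomial values is singular everywhere".

  A minor attains the bound. A part that still vanishes on rank \<open>r\<close> gains nothing in
  \<open>r\<close>; it only has fewer rows in which its terms differ, so a second induction on the
  number of such rows is needed.

  In the equality case \<open>r + 1\<close> monomials have to be tested at \<open>r + 1\<close>
  points of an \<open>r\<close>-dimensional space, and one linear dependence between the points, y +
  z, makes this possible. Three monomials are available only for r >= 2. For r = 1 the binomial x11
  x22 x33 - x12 x23 x31 vanishes on rank 1 and is not of the stated form.\<close>

text \<open>Over a finite field the product of all x - a, increased by 1, would have no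
  root.\<close>

lemma infinite_UNIV_alg_closed: "infinite (UNIV :: 'a::alg_closed_field set)"
proof
  assume fin: "finite (UNIV :: 'a set)"
  define p :: "'a poly" where "p = (\<Prod>a\<in>UNIV. [:-a, 1:])"
  have deg: "degree p = card (UNIV :: 'a set)"
    unfolding p_def by (subst degree_prod_eq_sum_degree) auto
  have pos: "card (UNIV :: 'a set) > 0"
    using fin by (simp add: card_gt_0_iff)
  have "degree (p + 1) = degree p"
    by (rule degree_add_eq_left) (use deg pos in simp)
  then obtain x where x: "poly (p + 1) x = 0"
    using alg_closed_imp_poly_has_root[of "p + 1"] deg pos by auto
  have "poly p x = (\<Prod>a\<in>UNIV. x - a)"
    by (simp add: p_def poly_prod)
  also have "\<dots> = 0"
    using fin by (auto simp: prod_zero_iff)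
  finally show False using x by simp
qed

lemma poly_vanish_eq_0:
  fixes p :: "'a::alg_closed_field poly"
  assumes "\<And>t. poly p t = 0"
  shows "p = 0"
  using poly_roots_finite[of p] infinite_UNIV_alg_closed[where 'a = 'a] assms by auto

text \<open>Being polynomial along every affine line suffices for cancellation and is preserved by
  sums, products and determinants, so polynomial rings in the entries of \<open>B\<close> and
  \<open>C\<close> are avoided.\<close>

definition line_poly :: "(('i \<Rightarrow> 'a::comm_ring_1) \<Rightarrow> 'a) \<Rightarrow> bool" where
  "line_poly F \<longleftrightarrow> (\<forall>p q. \<exists>P. \<forall>t. F (\<lambda>i. p i + t * q i) = poly P t)"

lemma line_poly_const [intro, simp]: "line_poly (\<lambda>w. c)"
  unfolding line_poly_def by (auto intro!: exI[of _ "[:c:]"])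

lemma line_poly_var [intro, simp]: "line_poly (\<lambda>w. w i)"
  unfolding line_poly_def
proof (intro allI)
  fix p q :: "'a \<Rightarrow> 'b"
  show "\<exists>P. \<forall>t. p i + t * q i = poly P t"
    by (rule exI[of _ "[:p i, q i:]"]) simp
qed

lemma line_poly_add [intro]: "line_poly F \<Longrightarrow> line_poly G \<Longrightarrow> line_poly (\<lambda>w. F w + G w)"
  unfolding line_poly_def
proof (intro allI)
  fix p q :: "'a \<Rightarrow> 'b"
  assume "\<forall>p q. \<exists>P. \<forall>t. F (\<lambda>i. p i + t * q i) = poly P t"
    "\<forall>p q. \<exists>P. \<forall>t. G (\<lambda>i. p i + t * q i) = poly P t"
  then obtain P Q where "\<forall>t. F (\<lambda>i. p i + t * q i) = poly P t" "\<forall>t. G (\<lambda>i. p i + t * q i) = poly Q t"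
    by blast
  then show "\<exists>P. \<forall>t. F (\<lambda>i. p i + t * q i) + G (\<lambda>i. p i + t * q i) = poly P t"
    by (intro exI[of _ "P + Q"]) simp
qed

lemma line_poly_diff [intro]: "line_poly F \<Longrightarrow> line_poly G \<Longrightarrow> line_poly (\<lambda>w. F w - G w)"
  unfolding line_poly_def
proof (intro allI)
  fix p q :: "'a \<Rightarrow> 'b"
  assume "\<forall>p q. \<exists>P. \<forall>t. F (\<lambda>i. p i + t * q i) = poly P t"
    "\<forall>p q. \<exists>P. \<forall>t. G (\<lambda>i. p i + t * q i) = poly P t"
  then obtain P Q where "\<forall>t. F (\<lambda>i. p i + t * q i) = poly P t" "\<forall>t. G (\<lambda>i. p i + t * q i) = poly Q t"
    by blast
  then show "\<exists>P. \<forall>t. F (\<lambda>i. p i + t * q i) - G (\<lambda>i. p i + t * q i) = poly P t"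
    by (intro exI[of _ "P - Q"]) simp
qed

lemma line_poly_mult [intro]: "line_poly F \<Longrightarrow> line_poly G \<Longrightarrow> line_poly (\<lambda>w. F w * G w)"
  unfolding line_poly_def
proof (intro allI)
  fix p q :: "'a \<Rightarrow> 'b"
  assume "\<forall>p q. \<exists>P. \<forall>t. F (\<lambda>i. p i + t * q i) = poly P t"
    "\<forall>p q. \<exists>P. \<forall>t. G (\<lambda>i. p i + t * q i) = poly P t"
  then obtain P Q where "\<forall>t. F (\<lambda>i. p i + t * q i) = poly P t" "\<forall>t. G (\<lambda>i. p i + t * q i) = poly Q t"
    by blast
  then show "\<exists>P. \<forall>t. F (\<lambda>i. p i + t * q i) * G (\<lambda>i. p i + t * q i) = poly P t"
    by (intro exI[of _ "P * Q"]) simp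
qed

lemma line_poly_power [intro]: "line_poly F \<Longrightarrow> line_poly (\<lambda>w. F w ^ k)"
  by (induction k) auto

lemma line_poly_sum [intro]:
  "(\<And>a. a \<in> A \<Longrightarrow> line_poly (F a)) \<Longrightarrow> line_poly (\<lambda>w. \<Sum>a\<in>A. F a w)"
  by (induction A rule: infinite_finite_induct) auto

lemma line_poly_prod [intro]:
  "(\<And>a. a \<in> A \<Longrightarrow> line_poly (F a)) \<Longrightarrow> line_poly (\<lambda>w. \<Prod>a\<in>A. F a w)"
  by (induction A rule: infinite_finite_induct) auto

lemma line_poly_det [intro]:
  assumes "\<And>i j. line_poly (\<lambda>w. M w i j)"
  shows "line_poly (\<lambda>w. det (mat N N (\<lambda>(i, j). M w i j)))"
proof -
  have "det (mat N N (\<lambda>(i, j). M w i j))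
      = (\<Sum>p | p permutes {0..<N}. signof p * (\<Prod>i = 0..<N. M w i (p i)))" for w
    unfolding det_def by (auto intro!: sum.cong prod.cong dest: permutes_in_image)
  then show ?thesis
    by (simp only:) (intro line_poly_sum line_poly_mult line_poly_prod line_poly_const assms)
qed

text \<open>Restricting to the line through a non-zero of each factor reduces the claim to
  univariate polynomials.\<close>
lemma line_poly_mult_eq_0:
  fixes F G :: "('i \<Rightarrow> 'a::alg_closed_field) \<Rightarrow> 'a"
  assumes "line_poly F" "line_poly G" and zero: "\<And>w. F w * G w = 0"
  shows "(\<forall>w. F w = 0) \<or> (\<forall>w. G w = 0)"
proof (rule ccontr)
  assume "\<not> ?thesis"
  then obtain u v where uv: "F u \<noteq> 0" "G v \<noteq> 0" by auto
  obtain P where P: "\<And>t. F (\<lambda>i. u i + t * (v i - u i)) = poly P t"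
    using assms(1)[unfolded line_poly_def, rule_format, of u "\<lambda>i. v i - u i"] by blast
  obtain Q where Q: "\<And>t. G (\<lambda>i. u i + t * (v i - u i)) = poly Q t"
    using assms(2)[unfolded line_poly_def, rule_format, of u "\<lambda>i. v i - u i"] by blast
  have "poly P 0 \<noteq> 0" "poly Q 1 \<noteq> 0"
    using uv P[of 0] Q[of 1] by simp_all
  moreover have "P * Q = 0"
    by (rule poly_vanish_eq_0) (use zero in \<open>simp flip: P Q\<close>)
  ultimately show False by auto
qed

section \<open>Monomials in one row and their linear independence\<close>

definition rmon :: "nat \<Rightarrow> (nat \<Rightarrow> nat) \<Rightarrow> (nat \<Rightarrow> 'a::comm_ring_1) \<Rightarrow> 'a" where
  "rmon n a y = (\<Prod>j<n. y j ^ a j)"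

lemma rmon_mult: "rmon n a (\<lambda>j. y j * z j) = rmon n a y * rmon n a z"
  by (simp add: rmon_def power_mult_distrib prod.distrib)

lemma rmon_add: "rmon n (\<lambda>j. a j + b j) y = rmon n a y * rmon n b y"
  by (simp add: rmon_def power_add prod.distrib)

lemma rmon_one [simp]: "rmon n a (\<lambda>_. 1) = 1"
  by (simp add: rmon_def)

lemma rmon_scale: "rmon n a (\<lambda>j. t * y j) = t ^ (\<Sum>j<n. a j) * rmon n a y"
  by (simp add: rmon_def power_mult_distrib prod.distrib power_sum)

lemma line_poly_rmon [intro]:
  "(\<And>j. line_poly (\<lambda>w. Y w j)) \<Longrightarrow> line_poly (\<lambda>w. rmon n a (Y w))"
  unfolding rmon_def by (intro line_poly_prod line_poly_power)

lemma power_distinct: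
  assumes "k \<noteq> l"
  shows "\<exists>t::'a::alg_closed_field. t ^ k \<noteq> t ^ l"
proof (rule ccontr)
  assume "\<not> ?thesis"
  then have "monom (1::'a) k - monom 1 l = 0"
    by (intro poly_vanish_eq_0) (simp add: poly_monom)
  then show False using assms by (simp add: monom_eq_iff')
qed

lemma rmon_separates:
  assumes "a \<noteq> b" "\<forall>j\<ge>n. a j = 0" "\<forall>j\<ge>n. b j = 0"
  shows "\<exists>z :: nat \<Rightarrow> 'a::alg_closed_field. rmon n a z \<noteq> rmon n b z"
proof -
  obtain j where j: "a j \<noteq> b j" using assms(1) by auto
  then have jn: "j < n" using assms(2,3) by (metis not_le)
  obtain t :: 'a where t: "t ^ a j \<noteq> t ^ b j" using power_distinct[OF j] by auto
  have "rmon n c (\<lambda>k. if k = j then t else 1) = t ^ c j" for c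
  proof -
    have "rmon n c (\<lambda>k. if k = j then t else 1) = (\<Prod>k<n. if k = j then t ^ c k else 1)"
      unfolding rmon_def by (rule prod.cong) auto
    then show ?thesis using jn by simp
  qed
  then show ?thesis using t by metis
qed

text \<open>Dedekind's argument for the independence of multiplicative functions.\<close>
lemma rmon_independent:
  fixes g :: "(nat \<Rightarrow> nat) \<Rightarrow> 'a::alg_closed_field"
  assumes "finite A" "\<forall>a\<in>A. \<forall>j\<ge>n. a j = 0" "\<forall>y. (\<Sum>a\<in>A. g a * rmon n a y) = 0"
  shows "\<forall>a\<in>A. g a = 0"
  using assms
proof (induction A arbitrary: g rule: finite_induct)
  case (insert x A)
  have A0: "g a = 0" if "a \<in> A" for a
  proof -
    have "a \<noteq> x" using that insert.hyps by auto
    moreover have "\<forall>j\<ge>n. a j = 0" "\<forall>j\<ge>n. x j = 0" using insert.prems(1) that by auto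
    ultimately obtain z :: "nat \<Rightarrow> 'a" where z: "rmon n a z \<noteq> rmon n x z"
      using rmon_separates by meson
    have "\<forall>y. (\<Sum>b\<in>A. (g b * (rmon n b z - rmon n x z)) * rmon n b y) = 0"
    proof
      fix y
      have 1: "g x * rmon n x z * rmon n x y + (\<Sum>b\<in>A. g b * rmon n b z * rmon n b y) = 0"
        using insert.prems(2)[rule_format, of "\<lambda>j. z j * y j"] insert.hyps
        by (simp add: rmon_mult mult_ac)
      have 2: "g x * rmon n x y + (\<Sum>b\<in>A. g b * rmon n b y) = 0"
        using insert.prems(2)[rule_format, of y] insert.hyps by simp
      have "(\<Sum>b\<in>A. (g b * (rmon n b z - rmon n x z)) * rmon n b y)
          = (\<Sum>b\<in>A. g b * rmon n b z * rmon n b y) - rmon n x z * (\<Sum>b\<in>A. g b * rmon n b y)"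
        by (simp add: algebra_simps sum_subtractf sum_distrib_left)
      also have "\<dots> = - (rmon n x z * (g x * rmon n x y + (\<Sum>b\<in>A. g b * rmon n b y)))"
        using 1 by (simp add: algebra_simps eq_neg_iff_add_eq_0)
      finally show "(\<Sum>b\<in>A. (g b * (rmon n b z - rmon n x z)) * rmon n b y) = 0"
        using 2 by simp
    qed
    moreover have "\<forall>a\<in>A. \<forall>j\<ge>n. a j = 0" using insert.prems(1) by blast
    ultimately have "\<forall>b\<in>A. g b * (rmon n b z - rmon n x z) = 0"
      by (intro insert.IH)
    then have "g a * (rmon n a z - rmon n x z) = 0" using that by (rule bspec)
    then show ?thesis using z by simp
  qed
  moreover have "g x = 0"
    using insert.prems(2)[rule_format, of "\<lambda>_. 1"] insert.hyps A0 by simp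
  ultimately show ?case by auto
qed auto

text \<open>Points are added greedily: one more function enlarges the space of relations holding at
  the chosen points to dimension at most one, and one more point outside the zero set of a spanning
  relation kills it. The prescribed points \<open>P\<close> serve the triple \<open>T\<close> of
  monomials tested at y, z and y + z; otherwise \<open>T\<close> is empty.\<close>

lemma extend_to_separating_points:
  fixes \<phi> :: "'s \<Rightarrow> 'y \<Rightarrow> 'a::field"
  assumes "finite D" "finite T" "D \<inter> T = {}"
    and "\<And>g. (\<forall>y. (\<Sum>a\<in>T \<union> D. g a * \<phi> a y) = 0) \<Longrightarrow> \<forall>a\<in>T \<union> D. g a = 0"
    and "\<And>g. (\<forall>y\<in>set P. (\<Sum>a\<in>T. g a * \<phi> a y) = 0) \<Longrightarrow> \<forall>a\<in>T. g a = 0"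
  shows "\<exists>Q. length Q = card D \<and>
    (\<forall>g. (\<forall>y\<in>set P \<union> set Q. (\<Sum>a\<in>T \<union> D. g a * \<phi> a y) = 0) \<longrightarrow> (\<forall>a\<in>T \<union> D. g a = 0))"
  using assms
proof (induction D rule: finite_induct)
  case empty
  show ?case using empty.prems(4) by (intro exI[of _ "[]"]) simp
next
  case (insert x D)
  have sum_insert: "(\<Sum>a\<in>T \<union> insert x D. g a * \<phi> a y) = g x * \<phi> x y + (\<Sum>a\<in>T \<union> D. g a * \<phi> a y)" for g y
    using insert.hyps insert.prems(1,2) by simp
  have x: "x \<notin> T \<union> D" using insert.hyps insert.prems(2) by auto
  have "\<forall>a\<in>T \<union> D. g a = 0" if "\<forall>y. (\<Sum>a\<in>T \<union> D. g a * \<phi> a y) = 0" for g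
  proof -
    have "(\<Sum>a\<in>T \<union> D. (g(x := 0)) a * \<phi> a y) = (\<Sum>a\<in>T \<union> D. g a * \<phi> a y)" for y
      using x by (intro sum.cong) auto
    then have "\<forall>y. (\<Sum>a\<in>T \<union> insert x D. (g(x := 0)) a * \<phi> a y) = 0"
      using that sum_insert[of "g(x := 0)"] by simp
    then have "\<forall>a\<in>T \<union> insert x D. (g(x := 0)) a = 0"
      by (rule insert.prems(3))
    then show ?thesis using x by (metis UnCI Un_insert_right fun_upd_other insertCI)
  qed
  note indep = this
  have "\<exists>Q. length Q = card D \<and>
    (\<forall>g. (\<forall>y\<in>set P \<union> set Q. (\<Sum>a\<in>T \<union> D. g a * \<phi> a y) = 0) \<longrightarrow> (\<forall>a\<in>T \<union> D. g a = 0))"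
  proof (rule insert.IH)
    show "finite T" "D \<inter> T = {}" using insert.prems(1,2) by auto
    show "\<forall>a\<in>T. g a = 0" if "\<forall>y\<in>set P. (\<Sum>a\<in>T. g a * \<phi> a y) = 0" for g
      using that by (rule insert.prems(4))
    show "\<forall>a\<in>T \<union> D. g a = 0" if "\<forall>y. (\<Sum>a\<in>T \<union> D. g a * \<phi> a y) = 0" for g
      using that by (rule indep)
  qed
  then obtain Q where Q: "length Q = card D"
    and trivial: "\<And>g. (\<forall>y\<in>set P \<union> set Q. (\<Sum>a\<in>T \<union> D. g a * \<phi> a y) = 0) \<Longrightarrow> \<forall>a\<in>T \<union> D. g a = 0"
    by (elim exE conjE) simp
  let ?ker = "\<lambda>g. \<forall>y\<in>set P \<union> set Q. (\<Sum>a\<in>T \<union> insert x D. g a * \<phi> a y) = 0"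
  have "\<exists>y. \<forall>g. ?ker g \<and> (\<Sum>a\<in>T \<union> insert x D. g a * \<phi> a y) = 0 \<longrightarrow> (\<forall>a\<in>T \<union> insert x D. g a = 0)"
  proof (cases "\<exists>g. ?ker g \<and> \<not> (\<forall>a\<in>T \<union> insert x D. g a = 0)")
    case True
    then obtain h where h: "?ker h" "\<not> (\<forall>a\<in>T \<union> insert x D. h a = 0)" by blast
    then obtain y where y: "(\<Sum>a\<in>T \<union> insert x D. h a * \<phi> a y) \<noteq> 0"
      using insert.prems(3)[of h] by blast
    have hx: "h x \<noteq> 0"
    proof
      assume 0: "h x = 0"
      then have "\<forall>y\<in>set P \<union> set Q. (\<Sum>a\<in>T \<union> D. h a * \<phi> a y) = 0"
        using h(1) unfolding sum_insert by simp
      then have "\<forall>a\<in>T \<union> D. h a = 0" by (rule trivial)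
      then show False using 0 h(2) by auto
    qed
    show ?thesis
    proof (intro exI allI impI)
      fix g assume g: "?ker g \<and> (\<Sum>a\<in>T \<union> insert x D. g a * \<phi> a y) = 0"
      \<comment> \<open>This combination has coefficient 0 at \<open>x\<close>, so the induction
        hypothesis forces \<open>g\<close> to be a multiple of \<open>h\<close>.\<close>
      define g' where "g' = (\<lambda>a. g a * h x - g x * h a)"
      have lin: "(\<Sum>a\<in>T \<union> insert x D. g' a * \<phi> a y)
          = h x * (\<Sum>a\<in>T \<union> insert x D. g a * \<phi> a y) - g x * (\<Sum>a\<in>T \<union> insert x D. h a * \<phi> a y)" for y
        unfolding g'_def sum_distrib_left sum_subtractf[symmetric]
        by (intro sum.cong) (auto simp: algebra_simps)
      have "g' x = 0" by (simp add: g'_def)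
      then have "\<forall>y\<in>set P \<union> set Q. (\<Sum>a\<in>T \<union> D. g' a * \<phi> a y) = 0"
        using lin g h(1) unfolding sum_insert[of g'] by simp
      then have "\<forall>a\<in>T \<union> D. g' a = 0" by (rule trivial)
      then have g'0: "\<forall>a\<in>T \<union> insert x D. g' a = 0" using \<open>g' x = 0\<close> by auto
      then have "(\<Sum>a\<in>T \<union> insert x D. g' a * \<phi> a y) = 0"
        by (intro sum.neutral) auto
      then have "g x = 0" using lin[of y] g y by simp
      show "\<forall>a\<in>T \<union> insert x D. g a = 0"
      proof
        fix a assume "a \<in> T \<union> insert x D"
        then have "g' a = 0" using g'0 by (rule bspec[rotated])
        then show "g a = 0" using \<open>g x = 0\<close> hx by (simp add: g'_def)
      qed
    qed
  qed blast
  then obtain y where y: "\<forall>g. ?ker g \<and> (\<Sum>a\<in>T \<union> insert x D. g a * \<phi> a y) = 0 \<longrightarrow> (\<forall>a\<in>T \<union> insert x D. g a = 0)"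
    by blast
  have "\<forall>a\<in>T \<union> insert x D. g a = 0"
    if g: "\<forall>z\<in>set P \<union> set (y # Q). (\<Sum>a\<in>T \<union> insert x D. g a * \<phi> a z) = 0" for g
  proof -
    have "?ker g" "(\<Sum>a\<in>T \<union> insert x D. g a * \<phi> a y) = 0"
      by (rule ballI, rule bspec[OF g], simp, rule bspec[OF g], simp)
    then show ?thesis by (intro mp[OF y[THEN spec[of _ g]]] conjI)
  qed
  moreover have "length (y # Q) = card (insert x D)" using Q insert.hyps by simp
  ultimately show ?case by blast
qed

section \<open>Vanishing on matrices of low rank\<close>

definition monev :: "nat \<Rightarrow> nat \<Rightarrow> (nat \<Rightarrow> nat \<Rightarrow> nat) \<Rightarrow> (nat \<Rightarrow> nat \<Rightarrow> 'a::comm_ring_1) \<Rightarrow> 'a" where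
  "monev m n \<mu> X = (\<Prod>i<m. rmon n (\<mu> i) (X i))"

definition mmul :: "nat \<Rightarrow> (nat \<Rightarrow> nat \<Rightarrow> 'a::comm_ring_1) \<Rightarrow> (nat \<Rightarrow> nat \<Rightarrow> 'a) \<Rightarrow> nat \<Rightarrow> nat \<Rightarrow> 'a" where
  "mmul r B C = (\<lambda>i j. \<Sum>k<r. B i k * C k j)"

text \<open>Terms are indexed by \<open>I\<close>, so that a part of the polynomial is a subset of
  \<open>I\<close> with unchanged \<open>c\<close> and \<open>\<mu>\<close>.\<close>

definition vanishing :: "nat \<Rightarrow> nat \<Rightarrow> nat \<Rightarrow> 's set \<Rightarrow> ('s \<Rightarrow> 'a::comm_ring_1) \<Rightarrow> ('s \<Rightarrow> nat \<Rightarrow> nat \<Rightarrow> nat) \<Rightarrow> bool" where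
  "vanishing m n r I c \<mu> \<longleftrightarrow> (\<forall>B C. (\<Sum>s\<in>I. c s * monev m n (\<mu> s) (mmul r B C)) = 0)"

definition off_row :: "nat \<Rightarrow> nat \<Rightarrow> nat \<Rightarrow> (nat \<Rightarrow> nat \<Rightarrow> nat) \<Rightarrow> (nat \<Rightarrow> nat \<Rightarrow> 'a::comm_ring_1) \<Rightarrow> 'a" where
  "off_row m n i \<mu> X = (\<Prod>i'\<in>{..<m} - {i}. rmon n (\<mu> i') (X i'))"

lemma monev_split: "i < m \<Longrightarrow> monev m n \<mu> X = off_row m n i \<mu> X * rmon n (\<mu> i) (X i)"
  unfolding monev_def off_row_def by (subst prod.remove[of _ i]) (auto simp: mult.commute)

lemma off_row_cong: "(\<And>i'. i' \<noteq> i \<Longrightarrow> X i' = Y i') \<Longrightarrow> off_row m n i \<mu> X = off_row m n i \<mu> Y"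
  unfolding off_row_def by (intro prod.cong) auto

lemma monev_add: "monev m n (\<lambda>i j. u i j + v i j) X = monev m n u X * monev m n v X"
  by (simp add: monev_def rmon_add prod.distrib)

lemma vanishingD: "vanishing m n r I c \<mu> \<Longrightarrow> (\<Sum>s\<in>I. c s * monev m n (\<mu> s) (mmul r B C)) = 0"
  by (simp add: vanishing_def)

lemma sum_by_row:
  assumes "finite I"
  shows "(\<Sum>s\<in>I. h s * rmon n (\<mu> s i) y)
       = (\<Sum>a\<in>(\<lambda>s. \<mu> s i) ` I. (\<Sum>s\<in>{s\<in>I. \<mu> s i = a}. h s) * rmon n a y)"
proof -
  have "(\<Sum>s\<in>I. h s * rmon n (\<mu> s i) y)
      = (\<Sum>a\<in>(\<lambda>s. \<mu> s i) ` I. \<Sum>s\<in>{s\<in>I. \<mu> s i = a}. h s * rmon n (\<mu> s i) y)"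
    using assms by (rule sum.image_gen)
  also have "\<dots> = (\<Sum>a\<in>(\<lambda>s. \<mu> s i) ` I. (\<Sum>s\<in>{s\<in>I. \<mu> s i = a}. h s) * rmon n a y)"
    by (intro sum.cong) (auto simp: sum_distrib_right)
  finally show ?thesis .
qed

text \<open>Row \<open>i\<close> of the product depends on \<open>B\<close> only through its row
  \<open>i\<close>. That row can be replaced by any \<open>t\<close> without affecting the other
  rows, hence without affecting the coefficients.\<close>

lemma vanishing_by_row:
  assumes "vanishing m n r I c \<mu>" "finite I" "i < m"
  shows "(\<Sum>a\<in>(\<lambda>s. \<mu> s i) ` I.
    (\<Sum>s\<in>{s\<in>I. \<mu> s i = a}. c s * off_row m n i (\<mu> s) (mmul r B C)) * rmon n a (mmul r (\<lambda>_. t) C i)) = 0"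
proof -
  define B' where "B' = B(i := t)"
  have row: "mmul r B' C i = mmul r (\<lambda>_. t) C i" by (simp add: mmul_def B'_def)
  have off: "off_row m n i (\<mu> s) (mmul r B' C) = off_row m n i (\<mu> s) (mmul r B C)" for s
    by (rule off_row_cong) (simp add: mmul_def B'_def)
  have "0 = (\<Sum>s\<in>I. c s * monev m n (\<mu> s) (mmul r B' C))"
    using assms(1) by (simp add: vanishing_def)
  also have "\<dots> = (\<Sum>s\<in>I. c s * off_row m n i (\<mu> s) (mmul r B C) * rmon n (\<mu> s i) (mmul r (\<lambda>_. t) C i))"
    by (intro sum.cong) (simp_all add: monev_split[OF assms(3)] off row mult.assoc)
  also have "\<dots> = (\<Sum>a\<in>(\<lambda>s. \<mu> s i) ` I.
    (\<Sum>s\<in>{s\<in>I. \<mu> s i = a}. c s * off_row m n i (\<mu> s) (mmul r B C)) * rmon n a (mmul r (\<lambda>_. t) C i))"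
    by (rule sum_by_row[OF assms(2)])
  finally show ?thesis by simp
qed

lemma monev_part:
  assumes "i < m"
  shows "(\<Sum>s\<in>{s\<in>I. \<mu> s i = a}. c s * monev m n (\<mu> s) X)
       = (\<Sum>s\<in>{s\<in>I. \<mu> s i = a}. c s * off_row m n i (\<mu> s) X) * rmon n a (X i)"
  unfolding sum_distrib_right
  by (intro sum.cong) (simp_all add: monev_split[OF assms] mult.assoc)

text \<open>A matrix of rank \<open>r\<close> stays of rank at most \<open>r + 1\<close> when one row is replaced by
  arbitrary entries.\<close>
lemma vanishing_pin_row:
  fixes c :: "'s \<Rightarrow> 'a::alg_closed_field"
  assumes "vanishing m n (Suc r) I c \<mu>" "finite I" "i < m" "\<forall>s\<in>I. \<forall>j\<ge>n. \<mu> s i j = 0"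
  shows "vanishing m n r {s\<in>I. \<mu> s i = a} c \<mu>"
  unfolding vanishing_def
proof (intro allI)
  fix B C :: "nat \<Rightarrow> nat \<Rightarrow> 'a"
  define g where "g a = (\<Sum>s\<in>{s\<in>I. \<mu> s i = a}. c s * off_row m n i (\<mu> s) (mmul r B C))" for a
  have "\<forall>y. (\<Sum>a\<in>(\<lambda>s. \<mu> s i) ` I. g a * rmon n a y) = 0"
  proof
    fix y :: "nat \<Rightarrow> 'a"
    \<comment> \<open>Column \<open>r\<close> of \<open>B'\<close> is zero, which makes room for
      \<open>y\<close> as the new row \<open>r\<close> of \<open>C'\<close>; the unit vector at
      \<open>r\<close> then selects \<open>y\<close> in row \<open>i\<close>.\<close>
    define B' where "B' = (\<lambda>i k. if k < r then B i k else 0)"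
    define C' where "C' = C(r := y)"
    have 1: "mmul (Suc r) B' C' = mmul r B C"
      unfolding mmul_def B'_def C'_def by (intro ext) simp
    have 2: "mmul (Suc r) (\<lambda>_ k. if k = r then 1 else 0) C' i = y"
      unfolding mmul_def C'_def by (intro ext) simp
    show "(\<Sum>a\<in>(\<lambda>s. \<mu> s i) ` I. g a * rmon n a y) = 0"
      using vanishing_by_row[OF assms(1-3), of B' C' "\<lambda>k. if k = r then 1 else 0"]
      unfolding 1 2 g_def by simp
  qed
  then have g0: "\<forall>a\<in>(\<lambda>s. \<mu> s i) ` I. g a = 0"
    using assms(2,4) by (intro rmon_independent) auto
  have "g a = 0"
  proof (cases "a \<in> (\<lambda>s. \<mu> s i) ` I")
    case False
    then have "{s\<in>I. \<mu> s i = a} = {}" by auto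
    then show ?thesis unfolding g_def by (simp only: sum.empty)
  qed (use g0 in blast)
  then show "(\<Sum>s\<in>{s\<in>I. \<mu> s i = a}. c s * monev m n (\<mu> s) (mmul r B C)) = 0"
    by (simp add: monev_part[OF assms(3)] g_def)
qed

lemma line_poly_mmul:
  "(\<And>i k. line_poly (\<lambda>w. B w i k)) \<Longrightarrow> (\<And>k j. line_poly (\<lambda>w. C w k j)) \<Longrightarrow> line_poly (\<lambda>w. mmul r (B w) (C w) i j)"
  unfolding mmul_def by (intro line_poly_sum line_poly_mult)

lemma line_poly_off_row:
  "(\<And>i j. line_poly (\<lambda>w. X w i j)) \<Longrightarrow> line_poly (\<lambda>w. off_row m n i \<mu> (X w))"
  unfolding off_row_def by (intro line_poly_prod line_poly_rmon)

lemma line_poly_monev: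
  "(\<And>i j. line_poly (\<lambda>w. X w i j)) \<Longrightarrow> line_poly (\<lambda>w. monev m n \<mu> (X w))"
  unfolding monev_def by (intro line_poly_prod line_poly_rmon)

text \<open>The tags \<open>True\<close> and \<open>False\<close> merge the entries of
  \<open>B\<close> and \<open>C\<close> into the coordinates of a single point.\<close>

lemma line_poly_mult_eq_0_pair:
  fixes F G :: "(nat \<Rightarrow> nat \<Rightarrow> 'a::alg_closed_field) \<Rightarrow> (nat \<Rightarrow> nat \<Rightarrow> 'a) \<Rightarrow> 'a"
  assumes F: "line_poly (\<lambda>w. F (\<lambda>i j. w (True, i, j)) (\<lambda>i j. w (False, i, j)))"
    and G: "line_poly (\<lambda>w. G (\<lambda>i j. w (True, i, j)) (\<lambda>i j. w (False, i, j)))"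
    and zero: "\<And>B C. F B C * G B C = 0"
  shows "(\<forall>B C. F B C = 0) \<or> (\<forall>B C. G B C = 0)"
proof -
  have *: "\<exists>w. B = (\<lambda>i j. w (True, i, j)) \<and> C = (\<lambda>i j. w (False, i, j))"
    for B C :: "nat \<Rightarrow> nat \<Rightarrow> 'a"
    by (rule exI[of _ "\<lambda>(x, i, j). if x then B i j else C i j"]) simp
  have "(\<forall>w. F (\<lambda>i j. w (True, i, j)) (\<lambda>i j. w (False, i, j)) = 0)
      \<or> (\<forall>w. G (\<lambda>i j. w (True, i, j)) (\<lambda>i j. w (False, i, j)) = 0)"
    by (rule line_poly_mult_eq_0[OF F G zero])
  then show ?thesis using * by metis
qed

text \<open>The coefficients of the row monomials solve a linear system whose matrix does not involve
  them; as not all of them are zero generically, the system is singular everywhere.\<close>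
lemma row_system_singular:
  fixes c :: "'s \<Rightarrow> 'a::alg_closed_field"
  assumes van: "vanishing m n r I c \<mu>" and fin: "finite I" and i: "i < m"
    and a: "\<not> vanishing m n r {s\<in>I. \<mu> s i = a} c \<mu>"
  defines "S \<equiv> (\<lambda>s. \<mu> s i) ` I"
  shows "\<exists>g :: _ \<Rightarrow> 'a. (\<exists>a\<in>S. g a \<noteq> 0) \<and> (\<forall>k<card S. (\<Sum>a\<in>S. g a * rmon n a (mmul r T C k)) = 0)"
proof -
  define N where "N = card S"
  have "finite S" using fin by (simp add: S_def)
  then obtain e where e: "bij_betw e {..<N} S"
    using ex_bij_betw_nat_finite[of S] by (auto simp: N_def atLeast0LessThan)
  define G where "G b B C = (\<Sum>s\<in>{s\<in>I. \<mu> s i = b}. c s * off_row m n i (\<mu> s) (mmul r B C))" for b B C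
  define M where "M C = mat N N (\<lambda>(k, l). rmon n (e l) (mmul r T C k))" for C
  have aS: "a \<in> S"
  proof (rule ccontr)
    assume "a \<notin> S"
    then have "{s\<in>I. \<mu> s i = a} = {}" by (auto simp: S_def)
    then show False using a unfolding vanishing_def by (simp only: sum.empty) simp
  qed
  have M_vec: "(M C *\<^sub>v vec N v) $ k = (\<Sum>b\<in>S. v (inv_into {..<N} e b) * rmon n b (mmul r T C k))"
    if "k < N" for C v k
  proof -
    have "(M C *\<^sub>v vec N v) $ k = (\<Sum>l<N. rmon n (e l) (mmul r T C k) * v l)"
      using that by (simp add: M_def scalar_prod_def atLeast0LessThan)
    also have "\<dots> = (\<Sum>l<N. v (inv_into {..<N} e (e l)) * rmon n (e l) (mmul r T C k))"
      using bij_betw_imp_inj_on[OF e] by (intro sum.cong) (simp_all add: mult.commute)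
    also have "\<dots> = (\<Sum>b\<in>S. v (inv_into {..<N} e b) * rmon n b (mmul r T C k))"
      by (rule sum.reindex_bij_betw[OF e])
    finally show ?thesis .
  qed
  have zero: "det (M C) * G a B C = 0" for B C
  proof (cases "G a B C = 0")
    case False
    define v where "v l = G (e l) B C" for l
    have "vec N v \<noteq> 0\<^sub>v N"
    proof
      assume "vec N v = 0\<^sub>v N"
      moreover obtain l where "l < N" "e l = a"
        using e aS unfolding bij_betw_def by auto
      ultimately have "v l = 0" by (metis index_vec index_zero_vec(1))
      then show False using False \<open>e l = a\<close> by (simp add: v_def)
    qed
    moreover have "M C *\<^sub>v vec N v = 0\<^sub>v N"
    proof (rule eq_vecI)
      fix k assume "k < dim_vec (0\<^sub>v N)"
      then have k: "k < N" by simp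
      have "(M C *\<^sub>v vec N v) $ k = (\<Sum>b\<in>S. G b B C * rmon n b (mmul r T C k))"
        unfolding M_vec[OF k] v_def
        using bij_betw_inv_into_right[OF e] by (intro sum.cong) auto
      also have "\<dots> = (\<Sum>b\<in>S. G b B C * rmon n b (mmul r (\<lambda>_. T k) C i))"
        by (simp add: mmul_def)
      also have "\<dots> = 0"
        using vanishing_by_row[OF van fin i] by (simp add: S_def G_def)
      finally show "(M C *\<^sub>v vec N v) $ k = 0\<^sub>v N $ k" using k by simp
    qed (simp add: M_def)
    moreover have "M C \<in> carrier_mat N N" by (simp add: M_def)
    ultimately have "det (M C) = 0"
      using det_0_iff_vec_prod_zero_field vec_carrier by blast
    then show ?thesis by simp
  qed simp
  have "(\<forall>(B :: nat \<Rightarrow> nat \<Rightarrow> 'a) C. det (M C) = 0) \<or> (\<forall>B C. G a B C = 0)"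
  proof (rule line_poly_mult_eq_0_pair[where F = "\<lambda>B C. det (M C)" and G = "G a"])
    show "line_poly (\<lambda>w. det (M (\<lambda>i j. w (False, i, j))))"
      unfolding M_def by (intro line_poly_det line_poly_rmon line_poly_mmul line_poly_const line_poly_var)
    show "line_poly (\<lambda>w. G a (\<lambda>i j. w (True, i, j)) (\<lambda>i j. w (False, i, j)))"
      unfolding G_def
      by (intro line_poly_sum line_poly_mult line_poly_off_row line_poly_mmul line_poly_const line_poly_var)
  qed (rule zero)
  moreover have "\<not> (\<forall>B C. G a B C = 0)"
    using a unfolding vanishing_def by (auto simp: monev_part[OF i] G_def)
  ultimately have "det (M C) = 0" for C by blast
  then obtain v where v: "v \<in> carrier_vec N" "v \<noteq> 0\<^sub>v N" "M C *\<^sub>v v = 0\<^sub>v N"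
    using det_0_iff_vec_prod_zero_field[of "M C" N] by (auto simp: M_def)
  have v_vec: "vec N (\<lambda>l. v $ l) = v" using v(1) by (intro eq_vecI) auto
  define g where "g b = v $ inv_into {..<N} e b" for b
  show ?thesis
  proof (intro exI conjI allI impI)
    show "\<exists>a\<in>S. g a \<noteq> 0"
    proof -
      obtain l where l: "l < N" "v $ l \<noteq> 0"
        using v(1,2) by (metis carrier_vecD eq_vecI index_zero_vec(1) index_zero_vec(2))
      have "g (e l) = v $ l"
        using bij_betw_imp_inj_on[OF e] l by (simp add: g_def)
      moreover have "e l \<in> S" using e l bij_betwE by blast
      ultimately show ?thesis using l by metis
    qed
    fix k assume "k < card S"
    then have k: "k < N" by (simp add: N_def)
    have "(\<Sum>a\<in>S. g a * rmon n a (mmul r T C k)) = (M C *\<^sub>v v) $ k"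
      using M_vec[OF k, of C "\<lambda>l. v $ l"] by (simp add: g_def v_vec)
    then show "(\<Sum>a\<in>S. g a * rmon n a (mmul r T C k)) = 0"
      using k v(3) by simp
  qed
qed

lemma mmul_unit: "k < r \<Longrightarrow> mmul r (\<lambda>k l. if k = l then 1 else 0) C k = C k"
  unfolding mmul_def by (intro ext) (simp add: if_distrib if_distribR cong: if_cong)

text \<open>Points separating the monomials number \<open>card S\<close>, at most \<open>r\<close>,
  so they fit into the rows of \<open>C\<close> and unit vectors select them. A singular system
  there contradicts the separation.\<close>

lemma vanishing_few_rows:
  fixes c :: "'s \<Rightarrow> 'a::alg_closed_field"
  assumes van: "vanishing m n r I c \<mu>" and fin: "finite I" and i: "i < m"
    and supp: "\<forall>s\<in>I. \<forall>j\<ge>n. \<mu> s i j = 0"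
    and few: "card ((\<lambda>s. \<mu> s i) ` I) \<le> r"
  shows "vanishing m n r {s\<in>I. \<mu> s i = a} c \<mu>"
proof (rule ccontr)
  assume a: "\<not> ?thesis"
  define S where "S = (\<lambda>s. \<mu> s i) ` I"
  have S: "finite S" "\<forall>a\<in>S. \<forall>j\<ge>n. a j = 0" using fin supp by (auto simp: S_def)
  have "\<exists>Q. length Q = card S \<and> (\<forall>g :: (nat \<Rightarrow> nat) \<Rightarrow> 'a.
    (\<forall>y\<in>set [] \<union> set Q. (\<Sum>a\<in>{} \<union> S. g a * rmon n a y) = 0) \<longrightarrow> (\<forall>a\<in>{} \<union> S. g a = 0))"
  proof (rule extend_to_separating_points)
    show "\<forall>a\<in>{} \<union> S. g a = 0" if "\<forall>y. (\<Sum>a\<in>{} \<union> S. g a * rmon n a y) = 0"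
      for g :: "(nat \<Rightarrow> nat) \<Rightarrow> 'a"
      using rmon_independent[OF S that[unfolded Un_empty_left]] by (simp only: Un_empty_left)
  qed (use S in simp_all)
  then obtain Q where lenQ: "length Q = card S" and Q: "\<forall>g :: (nat \<Rightarrow> nat) \<Rightarrow> 'a.
    (\<forall>y\<in>set Q. (\<Sum>a\<in>S. g a * rmon n a y) = 0) \<longrightarrow> (\<forall>a\<in>S. g a = 0)"
    unfolding set_empty set_simps Un_empty_left by blast
  obtain g where g: "\<exists>a\<in>S. g a \<noteq> 0"
    "\<And>k. k < card S \<Longrightarrow> (\<Sum>a\<in>S. g a * rmon n a (mmul r (\<lambda>k l. if k = l then 1 else 0) (\<lambda>k. Q ! k) k)) = 0"
    using row_system_singular[OF van fin i a, of "\<lambda>k l. if k = l then 1 else 0" "\<lambda>k. Q ! k"]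
    unfolding S_def by blast
  have "(\<Sum>a\<in>S. g a * rmon n a (Q ! k)) = 0" if "k < card S" for k
    using g(2)[OF that] that few by (subst (asm) mmul_unit) (simp_all add: S_def)
  then have "\<forall>y\<in>set Q. (\<Sum>a\<in>S. g a * rmon n a y) = 0"
    using lenQ by (metis in_set_conv_nth)
  then show False using Q g(1) by blast
qed

text \<open>The 3 x 3 determinant of the values of the monomials \<open>a\<close>, \<open>b\<close>,
  \<open>c\<close> (columns) at the points y, z, y + z (rows), expanded along the first row.\<close>

definition tri :: "nat \<Rightarrow> (nat \<Rightarrow> nat) \<Rightarrow> (nat \<Rightarrow> nat) \<Rightarrow> (nat \<Rightarrow> nat) \<Rightarrow> (nat \<Rightarrow> 'a::comm_ring_1) \<Rightarrow> (nat \<Rightarrow> 'a) \<Rightarrow> 'a" where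
  "tri n a b c y z =
      rmon n a y * (rmon n b z * rmon n c (\<lambda>j. y j + z j) - rmon n c z * rmon n b (\<lambda>j. y j + z j))
    - rmon n b y * (rmon n a z * rmon n c (\<lambda>j. y j + z j) - rmon n c z * rmon n a (\<lambda>j. y j + z j))
    + rmon n c y * (rmon n a z * rmon n b (\<lambda>j. y j + z j) - rmon n b z * rmon n a (\<lambda>j. y j + z j))"

text \<open>Cramer's rule: the determinant times each unknown is a combination of the three
  equations with cofactors as coefficients.\<close>

lemma three_by_three_kernel:
  fixes p :: "'a::field"
  assumes "p * a1 + q * b1 + s * c1 = 0" "p * a2 + q * b2 + s * c2 = 0" "p * a3 + q * b3 + s * c3 = 0"
    and "a1 * (b2 * c3 - c2 * b3) - b1 * (a2 * c3 - c2 * a3) + c1 * (a2 * b3 - b2 * a3) \<noteq> 0"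
  shows "p = 0" "q = 0" "s = 0"
proof -
  define d where "d = a1 * (b2 * c3 - c2 * b3) - b1 * (a2 * c3 - c2 * a3) + c1 * (a2 * b3 - b2 * a3)"
  have "p * d = (p * a1 + q * b1 + s * c1) * (b2 * c3 - c2 * b3)
      - (p * a2 + q * b2 + s * c2) * (b1 * c3 - c1 * b3) + (p * a3 + q * b3 + s * c3) * (b1 * c2 - c1 * b2)"
    by (simp add: d_def algebra_simps)
  also have "\<dots> = 0" unfolding assms(1-3) by simp
  finally show "p = 0" using assms(4) by (simp add: d_def)
  have "q * d = - (p * a1 + q * b1 + s * c1) * (a2 * c3 - c2 * a3)
      + (p * a2 + q * b2 + s * c2) * (a1 * c3 - c1 * a3) - (p * a3 + q * b3 + s * c3) * (a1 * c2 - c1 * a2)"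
    by (simp add: d_def algebra_simps)
  also have "\<dots> = 0" unfolding assms(1-3) by simp
  finally show "q = 0" using assms(4) by (simp add: d_def)
  have "s * d = (p * a1 + q * b1 + s * c1) * (a2 * b3 - b2 * a3)
      - (p * a2 + q * b2 + s * c2) * (a1 * b3 - b1 * a3) + (p * a3 + q * b3 + s * c3) * (a1 * b2 - b1 * a2)"
    by (simp add: d_def algebra_simps)
  also have "\<dots> = 0" unfolding assms(1-3) by simp
  finally show "s = 0" using assms(4) by (simp add: d_def)
qed

text \<open>If the determinant were nonzero, y, z and y + z would separate the three monomials, and
  \<open>r - 2\<close> further points would separate all \<open>r + 1\<close>. These
  \<open>r + 1\<close> points need only \<open>r\<close> rows of \<open>C\<close>, because y + z is
  the sum of two of them; this contradicts the singular system.\<close>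

lemma vanishing_tri:
  fixes c :: "'s \<Rightarrow> 'a::alg_closed_field"
  assumes van: "vanishing m n r I c \<mu>" and fin: "finite I" and i: "i < m"
    and supp: "\<forall>s\<in>I. \<forall>j\<ge>n. \<mu> s i j = 0" and r: "2 \<le> r"
    and card: "card ((\<lambda>s. \<mu> s i) ` I) = Suc r"
    and nv: "\<not> vanishing m n r {s\<in>I. \<mu> s i = a0} c \<mu>"
    and abd: "a \<in> (\<lambda>s. \<mu> s i) ` I" "b \<in> (\<lambda>s. \<mu> s i) ` I" "d \<in> (\<lambda>s. \<mu> s i) ` I" "a \<noteq> b" "a \<noteq> d" "b \<noteq> d"
  shows "tri n a b d (y :: nat \<Rightarrow> 'a) z = 0"
proof (rule ccontr)
  assume tri: "tri n a b d y z \<noteq> 0"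
  define S where "S = (\<lambda>s. \<mu> s i) ` I"
  define x where "x = (\<lambda>j. y j + z j)"
  define T where "T = {a, b, d}"
  define D where "D = S - T"
  have S: "finite S" "\<forall>a\<in>S. \<forall>j\<ge>n. a j = 0" using fin supp by (auto simp: S_def)
  have TD: "T \<union> D = S" "T \<inter> D = {}" using abd by (auto simp: T_def D_def S_def)
  have cardT: "card T = 3" using abd by (simp add: T_def)
  have cardD: "card D = r - 2"
  proof -
    have "T \<subseteq> S" "finite T" using TD by (auto simp: T_def)
    then have "card D = card S - card T" unfolding D_def by (rule card_Diff_subset[rotated])
    then show ?thesis using card cardT by (simp add: S_def)
  qed
  have "\<exists>Q. length Q = card D \<and> (\<forall>g :: (nat \<Rightarrow> nat) \<Rightarrow> 'a.
    (\<forall>y\<in>set [y, z, x] \<union> set Q. (\<Sum>a\<in>T \<union> D. g a * rmon n a y) = 0) \<longrightarrow> (\<forall>a\<in>T \<union> D. g a = 0))"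
  proof (rule extend_to_separating_points)
    show "\<forall>a\<in>T \<union> D. g a = 0" if "\<forall>y. (\<Sum>a\<in>T \<union> D. g a * rmon n a y) = 0"
      for g :: "(nat \<Rightarrow> nat) \<Rightarrow> 'a"
      using rmon_independent[OF S that[unfolded TD]] by (simp only: TD)
    show "\<forall>a\<in>T. g a = 0" if g: "\<forall>y\<in>set [y, z, x]. (\<Sum>a\<in>T. g a * rmon n a y) = 0"
      for g :: "(nat \<Rightarrow> nat) \<Rightarrow> 'a"
    proof -
      have sumT: "(\<Sum>a\<in>T. g a * rmon n a y) = g a * rmon n a y + g b * rmon n b y + g d * rmon n d y" for y
        using abd by (simp add: T_def add.assoc)
      have 0: "g a * rmon n a u + g b * rmon n b u + g d * rmon n d u = 0" if "u \<in> set [y, z, x]" for u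
        using g that sumT by metis
      note ker = three_by_three_kernel[OF 0[of y] 0[of z] 0[of x]]
      have "g a = 0" "g b = 0" "g d = 0"
        using ker tri unfolding tri_def x_def[symmetric] by simp_all
      then show ?thesis by (simp add: T_def)
    qed
  qed (use S TD in \<open>auto simp: D_def T_def\<close>)
  then obtain Q where lenQ: "length Q = card D" and Q: "\<forall>g :: (nat \<Rightarrow> nat) \<Rightarrow> 'a.
    (\<forall>y\<in>set [y, z, x] \<union> set Q. (\<Sum>a\<in>S. g a * rmon n a y) = 0) \<longrightarrow> (\<forall>a\<in>S. g a = 0)"
    unfolding TD by blast
  \<comment> \<open>The first \<open>r\<close> rows of \<open>W\<close> select the rows of
    \<open>C\<close>; row \<open>r\<close> adds the first two of them, which are \<open>y\<close>
    and \<open>z\<close>.\<close>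
  define W where "W k l = (if k = r then (if l < 2 then 1 else 0) else if k = l then 1 else 0 :: 'a)" for k l :: nat
  define C where "C k = (y # z # Q) ! k" for k
  have W1: "mmul r W C k = C k" if "k < r" for k
    using that mmul_unit[of k r C] by (simp add: mmul_def W_def)
  have W2: "mmul r W C r = x"
  proof
    fix j
    have "mmul r W C r j = (\<Sum>l\<in>{..<r}. if l < 2 then C l j else 0)"
      unfolding mmul_def W_def by (intro sum.cong) auto
    also have "\<dots> = (\<Sum>l\<in>{0,1}. C l j)"
      using r by (intro sum.mono_neutral_cong_right) auto
    also have "\<dots> = x j" by (simp add: C_def x_def)
    finally show "mmul r W C r j = x j" .
  qed
  obtain g where g: "\<exists>a\<in>S. g a \<noteq> 0"
    "\<And>k. k < card S \<Longrightarrow> (\<Sum>a\<in>S. g a * rmon n a (mmul r W C k)) = 0"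
    using row_system_singular[OF van fin i nv, of W C] unfolding S_def by blast
  have "(\<Sum>a\<in>S. g a * rmon n a u) = 0" if u: "u \<in> set [y, z, x] \<union> set Q" for u
  proof (cases "u = x")
    case True
    then show ?thesis using g(2)[of r] card W2 by (simp add: S_def)
  next
    case False
    then have "u \<in> set (y # z # Q)" using u by auto
    then obtain k where k: "k < length (y # z # Q)" "u = C k"
      unfolding C_def by (metis in_set_conv_nth)
    then have "k < r" using lenQ cardD r by simp
    then show ?thesis using g(2)[of k] card W1[of k] k(2) by (simp add: S_def)
  qed
  then show False using Q g(1) by blast
qed

section \<open>Relations between three monomials\<close>

lemma rmon_eq_1: "(\<And>l. l < n \<Longrightarrow> 0 < a l \<Longrightarrow> y l = 1) \<Longrightarrow> rmon n a y = 1"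
  unfolding rmon_def by (rule prod.neutral) (metis lessThan_iff power_0 power_one gr0I)

lemma rmon_eq_0:
  fixes y :: "nat \<Rightarrow> 'a::idom"
  shows "l < n \<Longrightarrow> 0 < a l \<Longrightarrow> y l = 0 \<Longrightarrow> rmon n a y = 0"
  unfolding rmon_def by (rule prod_zero) (auto intro!: bexI[of _ l])

lemma rmon_at:
  assumes "i < n" "\<And>l. l < n \<Longrightarrow> l \<noteq> i \<Longrightarrow> 0 < a l \<Longrightarrow> y l = 1"
  shows "rmon n a y = y i ^ a i"
proof -
  have "rmon n a y = y i ^ a i * (\<Prod>l\<in>{..<n} - {i}. y l ^ a l)"
    unfolding rmon_def using assms(1) by (intro prod.remove) auto
  also have "(\<Prod>l\<in>{..<n} - {i}. y l ^ a l) = 1"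
    by (rule prod.neutral) (metis DiffE assms(2) insertCI lessThan_iff power_0 power_one gr0I)
  finally show ?thesis by simp
qed

lemma tri_rotate: "tri n b c a y z = tri n a b c y z"
  unfolding tri_def by (simp add: algebra_simps)

lemma tri_swap: "tri n a c b y z = - tri n a b c y z"
  unfolding tri_def by (simp add: algebra_simps)

text \<open>Cancelling the smaller powers leaves (1 + t)^d = t^d with d > 0 as polynomials, which
  fails at 0.\<close>

lemma shifted_power_products_eq:
  assumes "\<And>t::'a::alg_closed_field. t ^ k * (1 + t) ^ l = t ^ l * (1 + t) ^ k"
  shows "k = l"
proof -
  have False if 1: "k < l" and 2: "\<And>t::'a. t ^ k * (1 + t) ^ l = t ^ l * (1 + t) ^ k" for k l
  proof -
    define d where "d = l - k"
    have d: "l = k + d" "0 < d" using 1 by (auto simp: d_def)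
    define X :: "'a poly" where "X = [:0, 1:]"
    define Y :: "'a poly" where "Y = [:1, 1:]"
    have "X ^ k * Y ^ k * (Y ^ d - X ^ d) = 0"
    proof (rule poly_vanish_eq_0)
      fix t
      have "poly (X ^ k * Y ^ k * (Y ^ d - X ^ d)) t = t ^ k * (1 + t) ^ l - t ^ l * (1 + t) ^ k"
        by (simp add: X_def Y_def d(1) power_add algebra_simps)
      then show "poly (X ^ k * Y ^ k * (Y ^ d - X ^ d)) t = 0" using 2 by simp
    qed
    then have "Y ^ d - X ^ d = 0" by (simp add: X_def Y_def)
    then have "poly (Y ^ d - X ^ d) 0 = 0" by simp
    then show False using d(2) by (simp add: X_def Y_def zero_power)
  qed
  then show ?thesis using assms by (metis nat_neq_iff)
qed

text \<open>The parameter \<open>K\<close> only makes the field visible in the locale predicate.\<close>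
locale tri_vanishing =
  fixes n :: nat and a b c :: "nat \<Rightarrow> nat" and K :: "'a::alg_closed_field itself"
  assumes field: "K = TYPE('a)"
    and tri_0: "\<And>y z :: nat \<Rightarrow> 'a. tri n a b c y z = 0"
    and coprime: "\<And>j. j < n \<Longrightarrow> a j = 0 \<or> b j = 0 \<or> c j = 0"
    and distinct: "a \<noteq> b" "a \<noteq> c" "b \<noteq> c"
    and degree: "(\<Sum>j<n. b j) = (\<Sum>j<n. a j)" "(\<Sum>j<n. c j) = (\<Sum>j<n. a j)"
    and support: "\<And>j. n \<le> j \<Longrightarrow> a j = 0" "\<And>j. n \<le> j \<Longrightarrow> b j = 0" "\<And>j. n \<le> j \<Longrightarrow> c j = 0"
begin

lemma rotated: "tri_vanishing n b c a K"
proof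
  show "b j = 0 \<or> c j = 0 \<or> a j = 0" if "j < n" for j using coprime[OF that] by auto
  show "tri n b c a y z = 0" for y z :: "nat \<Rightarrow> 'a" using tri_0 by (simp add: tri_rotate)
qed (use field coprime distinct degree support in auto)

lemma swapped: "tri_vanishing n a c b K"
proof
  show "a j = 0 \<or> c j = 0 \<or> b j = 0" if "j < n" for j using coprime[OF that] by auto
  show "tri n a c b y z = 0" for y z :: "nat \<Rightarrow> 'a" by (simp add: tri_swap[of n a c b] tri_0)
qed (use field coprime distinct degree support in auto)

text \<open>At suitable 0-1 points the determinant becomes triangular with unit diagonal. By
  \<open>coprime\<close>, exactly one of y and z is 1 at each variable of \<open>c\<close>, so the
  value of \<open>c\<close> at y + z is 1 in every characteristic.\<close>

lemma overlap_support:
  assumes j: "j < n" "a j = 0" "0 < b j" "0 < c j" and l: "l < n" "b l = 0" "0 < c l"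
  shows False
proof -
  define y :: "nat \<Rightarrow> 'a" where "y x = (if b x = 0 \<or> 0 < a x then 1 else 0)" for x
  define z :: "nat \<Rightarrow> 'a" where "z x = (if 0 < b x then 1 else 0)" for x
  have "rmon n a y = 1" by (rule rmon_eq_1) (simp add: y_def)
  moreover have "rmon n b z = 1" by (rule rmon_eq_1) (simp add: z_def)
  moreover have "rmon n c (\<lambda>j. y j + z j) = 1"
  proof (rule rmon_eq_1)
    fix x assume "x < n" "0 < c x"
    then show "y x + z x = 1" using coprime[of x] by (auto simp: y_def z_def)
  qed
  moreover have "rmon n b y = 0" "rmon n c y = 0"
    using j by (auto intro!: rmon_eq_0[of j] simp: y_def)
  moreover have "rmon n c z = 0" using l by (intro rmon_eq_0[of l]) (auto simp: z_def)
  ultimately have "tri n a b c y z = 1" by (simp add: tri_def)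
  then show False using tri_0[of y z] by simp
qed

text \<open>By the preceding lemma and its mirror image, \<open>b\<close> and \<open>c\<close> have
  the same support. Being distinct of equal degree, they differ at some \<open>i\<close> other than
  \<open>j\<close>; a parameter t placed at \<open>i\<close> gives an identity of powers that forces
  equal exponents there.\<close>

lemma overlap:
  assumes j: "j < n" "a j = 0" "0 < b j" "0 < c j"
  shows False
proof -
  interpret sw: tri_vanishing n a c b K by (rule swapped)
  have same: "b l = 0 \<longleftrightarrow> c l = 0" if "l < n" for l
    using overlap_support[OF j that] sw.overlap_support[OF j(1,2,4,3) that] by auto
  have "\<exists>i<n. i \<noteq> j \<and> b i \<noteq> c i"
  proof (rule ccontr)
    assume "\<not> ?thesis"
    then have eq: "\<And>i. i < n \<Longrightarrow> i \<noteq> j \<Longrightarrow> b i = c i" by auto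
    have "(\<Sum>i<n. f i) = f j + (\<Sum>i\<in>{..<n} - {j}. f i)" for f :: "nat \<Rightarrow> nat"
      using j(1) by (intro sum.remove) auto
    moreover have "(\<Sum>i\<in>{..<n} - {j}. b i) = (\<Sum>i\<in>{..<n} - {j}. c i)"
      using eq by (intro sum.cong) auto
    ultimately have "b j = c j" using degree by (metis add_right_cancel)
    then have "b = c" using eq support by (intro ext) (metis not_le)
    then show False using distinct by simp
  qed
  then obtain i where i: "i < n" "i \<noteq> j" "b i \<noteq> c i" by auto
  have "t ^ b i * (1 + t) ^ c i = t ^ c i * (1 + t) ^ b i" for t :: 'a
  proof -
    \<comment> \<open>The zero at \<open>j\<close> kills \<open>b\<close> and \<open>c\<close> at y,
      so a single 2 x 2 minor remains. On the common support y + z is 1, except at \<open>i\<close>,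
      where it is 1 + t.\<close>
    define y :: "nat \<Rightarrow> 'a" where "y l = (if l = i \<or> b l = 0 then 1 else 0)" for l
    define z :: "nat \<Rightarrow> 'a" where "z l = (if l = i then t else 1)" for l
    have "rmon n a y = 1"
      by (rule rmon_eq_1) (use coprime same in \<open>force simp: y_def\<close>)
    moreover have "rmon n b y = 0" "rmon n c y = 0"
      using j i by (auto intro!: rmon_eq_0[of j] simp: y_def)
    moreover have "rmon n b z = t ^ b i" "rmon n c z = t ^ c i"
      using i by (subst rmon_at[of i]; simp add: z_def)+
    moreover have "rmon n b (\<lambda>j. y j + z j) = (1 + t) ^ b i" "rmon n c (\<lambda>j. y j + z j) = (1 + t) ^ c i"
      using i same by (subst rmon_at[of i]; force simp: z_def y_def)+
    ultimately show ?thesis using tri_0[of y z] by (simp add: tri_def)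
  qed
  then show False using shifted_power_products_eq i(3) by blast
qed

lemma disjoint_supports: "j < n \<Longrightarrow> 0 < b j \<Longrightarrow> 0 < c j \<Longrightarrow> False"
  using overlap coprime by (metis gr0I less_nat_zero_code)

lemma disjoint:
  assumes "j < n"
  shows "b j = 0 \<or> c j = 0" "a j = 0 \<or> b j = 0" "a j = 0 \<or> c j = 0"
proof -
  interpret r1: tri_vanishing n b c a K by (rule rotated)
  interpret r2: tri_vanishing n c a b K by (rule r1.rotated)
  show "b j = 0 \<or> c j = 0" "a j = 0 \<or> b j = 0" "a j = 0 \<or> c j = 0"
    using disjoint_supports r1.disjoint_supports r2.disjoint_supports assms by (meson gr0I)+
qed

lemma degree_pos: "0 < (\<Sum>j<n. a j)"
proof (rule ccontr)
  assume "\<not> ?thesis"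
  then have "(\<Sum>j<n. a j) = 0" "(\<Sum>j<n. b j) = 0" using degree by auto
  then have "a l = b l" for l using support by (cases "l < n") auto
  then show False using distinct by blast
qed

text \<open>If \<open>c\<close> involved a second variable, it could vanish at y through one
  variable and at z through the other, yet equal 1 at y + z. A zero of z in a variable of
  \<open>a\<close> then leaves only the product of \<open>a\<close> at y, \<open>b\<close> at z and
  \<open>c\<close> at y + z.\<close>

lemma pure_power: "\<exists>k<n. c = (\<lambda>l. if l = k then \<Sum>j<n. a j else 0)"
proof -
  obtain k where k: "k < n" "0 < c k"
  proof -
    have "(\<Sum>j<n. c j) \<noteq> 0" using degree degree_pos by linarith
    then show ?thesis using that by (meson gr0I lessThan_iff sum.neutral)
  qed
  obtain p where p: "p < n" "0 < a p"
  proof -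
    have "(\<Sum>j<n. a j) \<noteq> 0" using degree_pos by linarith
    then show ?thesis using that by (meson gr0I lessThan_iff sum.neutral)
  qed
  have zero: "c i = 0" if i: "i < n" "i \<noteq> k" for i
  proof (rule ccontr)
    assume ci: "c i \<noteq> 0"
    define y :: "nat \<Rightarrow> 'a" where "y l = (if l = k then 0 else 1)" for l
    define z :: "nat \<Rightarrow> 'a" where "z l = (if l = p \<or> (0 < c l \<and> l \<noteq> k) then 0 else 1)" for l
    have pk: "p \<noteq> k" using disjoint[of k] k p by auto
    have "rmon n c y = 0" using k by (intro rmon_eq_0[of k]) (auto simp: y_def)
    moreover have "rmon n c z = 0" using i ci by (intro rmon_eq_0[of i]) (auto simp: z_def)
    moreover have "rmon n a z = 0" using p by (intro rmon_eq_0[of p]) (auto simp: z_def)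
    moreover have "rmon n a y = 1" "rmon n b y = 1"
      using k disjoint[of k] by (auto intro!: rmon_eq_1 simp: y_def)
    moreover have "rmon n b z = 1"
    proof (rule rmon_eq_1)
      fix l assume l: "l < n" "0 < b l"
      then have "l \<noteq> p" "c l = 0" using disjoint(1)[of l] disjoint(2)[of l] p by auto
      then show "z l = 1" by (simp add: z_def)
    qed
    moreover have "rmon n c (\<lambda>j. y j + z j) = 1"
    proof (rule rmon_eq_1)
      fix l assume l: "l < n" "0 < c l"
      then have "l \<noteq> p" using disjoint(3)[of l] p by auto
      then show "y l + z l = 1" using l pk by (auto simp: y_def z_def)
    qed
    ultimately have "tri n a b c y z = 1" by (simp add: tri_def)
    then show False using tri_0[of y z] by simp
  qed
  have "(\<Sum>j<n. c j) = c k + (\<Sum>j\<in>{..<n} - {k}. c j)"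
    using k by (intro sum.remove) auto
  also have "(\<Sum>j\<in>{..<n} - {k}. c j) = 0" using zero by (intro sum.neutral) auto
  finally have "c k = (\<Sum>j<n. a j)" using degree by simp
  then have "c = (\<lambda>l. if l = k then \<Sum>j<n. a j else 0)"
    using zero support by (intro ext) (metis not_le)
  then show ?thesis using k by blast
qed

lemma pure_powers:
  obtains i j k d where "i < n" "j < n" "k < n" "i \<noteq> j" "i \<noteq> k" "j \<noteq> k" "0 < d"
    "a = (\<lambda>l. if l = i then d else 0)" "b = (\<lambda>l. if l = j then d else 0)"
    "c = (\<lambda>l. if l = k then d else 0)" "\<And>t::'a. (1 + t) ^ d = 1 + t ^ d"
proof -
  interpret r1: tri_vanishing n b c a K by (rule rotated)
  interpret r2: tri_vanishing n c a b K by (rule r1.rotated)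
  define d where "d = (\<Sum>j<n. a j)"
  have d: "0 < d" using degree_pos by (simp add: d_def)
  obtain i where i: "i < n" "a = (\<lambda>l. if l = i then d else 0)"
    using r1.pure_power unfolding d_def degree by blast
  obtain j where j: "j < n" "b = (\<lambda>l. if l = j then d else 0)"
    using r2.pure_power unfolding d_def degree by blast
  obtain k where k: "k < n" "c = (\<lambda>l. if l = k then d else 0)"
    using pure_power unfolding d_def by blast
  have ne: "i \<noteq> j" "i \<noteq> k" "j \<noteq> k"
    using distinct i j k by auto
  have "(1 + t) ^ d = 1 + t ^ d" for t :: 'a
  proof -
    \<comment> \<open>With these points the rows of the determinant are (1, 0, 1), (0, 1, t^d) and
      (1, 1, (1 + t)^d).\<close>
    define y :: "nat \<Rightarrow> 'a" where "y l = (if l = j then 0 else 1)" for l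
    define z :: "nat \<Rightarrow> 'a" where "z l = (if l = i then 0 else if l = k then t else 1)" for l
    have ev: "rmon n (\<lambda>l. if l = p then d else 0) x = x p ^ d" if "p < n" for p and x :: "nat \<Rightarrow> 'a"
      using that by (subst rmon_at[of p]) auto
    have "tri n a b c y z = (1 + t) ^ d - t ^ d - 1"
      using ne d unfolding tri_def i(2) j(2) k(2) ev[OF i(1)] ev[OF j(1)] ev[OF k(1)]
      by (simp add: y_def z_def)
    then show ?thesis using tri_0[of y z] by (simp add: algebra_simps)
  qed
  then show ?thesis using that i j k ne d by blast
qed

end

section \<open>Removing the common divisor of three monomials\<close>

lemma line_poly_tri:
  "(\<And>j. line_poly (\<lambda>w. Y w j)) \<Longrightarrow> (\<And>j. line_poly (\<lambda>w. Z w j)) \<Longrightarrow> line_poly (\<lambda>w. tri n a b c (Y w) (Z w))"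
  unfolding tri_def
  by (intro line_poly_add line_poly_diff line_poly_mult line_poly_rmon)

lemma tri_shift:
  "tri n (\<lambda>j. u j + a j) (\<lambda>j. u j + b j) (\<lambda>j. u j + c j) y z
   = rmon n u y * rmon n u z * rmon n u (\<lambda>j. y j + z j) * tri n a b c y z"
  unfolding tri_def rmon_add by (simp add: algebra_simps)

lemma tri_cancel:
  assumes "\<And>y z :: nat \<Rightarrow> 'a::alg_closed_field. tri n (\<lambda>j. u j + a j) (\<lambda>j. u j + b j) (\<lambda>j. u j + c j) y z = 0"
  shows "tri n a b c (y :: nat \<Rightarrow> 'a) z = 0"
proof -
  let ?Y = "\<lambda>w j. w (True, j)" and ?Z = "\<lambda>w j. w (False, j)"
  have "(\<forall>w :: _ \<Rightarrow> 'a. rmon n u (?Y w) * rmon n u (?Z w) * rmon n u (\<lambda>j. ?Y w j + ?Z w j) = 0)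
      \<or> (\<forall>w :: _ \<Rightarrow> 'a. tri n a b c (?Y w) (?Z w) = 0)"
  proof (rule line_poly_mult_eq_0[where F = "\<lambda>w. rmon n u (?Y w) * rmon n u (?Z w) * rmon n u (\<lambda>j. ?Y w j + ?Z w j)"
        and G = "\<lambda>w. tri n a b c (?Y w) (?Z w)"])
    show "rmon n u (?Y w) * rmon n u (?Z w) * rmon n u (\<lambda>j. ?Y w j + ?Z w j) * tri n a b c (?Y w) (?Z w) = 0"
      for w :: "_ \<Rightarrow> 'a"
      using assms[of "?Y w" "?Z w"] by (simp only: tri_shift)
  qed (intro line_poly_mult line_poly_rmon line_poly_tri line_poly_add line_poly_var)+
  moreover have "\<not> (\<forall>w :: _ \<Rightarrow> 'a. rmon n u (?Y w) * rmon n u (?Z w) * rmon n u (\<lambda>j. ?Y w j + ?Z w j) = 0)"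
  proof -
    \<comment> \<open>At y = 1 and z = t all coordinates of y, z and y + z are then nonzero, so the
      factor to be cancelled is not identically zero.\<close>
    obtain t :: 'a where t: "t \<notin> {0, -1}"
      using ex_new_if_finite[OF infinite_UNIV_alg_closed[where 'a = 'a], of "{0, -1}"] by auto
    define w :: "bool \<times> nat \<Rightarrow> 'a" where "w p = (if fst p then 1 else t)" for p
    have "1 + t \<noteq> 0" using t by (metis add_eq_0_iff insertI1 insertI2)
    then have "rmon n u (?Y w) * rmon n u (?Z w) * rmon n u (\<lambda>j. ?Y w j + ?Z w j) \<noteq> 0"
      using t by (simp add: w_def rmon_def)
    then show ?thesis by blast
  qed
  ultimately have "\<forall>w :: _ \<Rightarrow> 'a. tri n a b c (?Y w) (?Z w) = 0" by blast
  from this[rule_format, of "\<lambda>p. if fst p then y (snd p) else z (snd p)"] show ?thesis by simp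
qed

lemma tri_zero_shape:
  assumes tri: "\<And>y z :: nat \<Rightarrow> 'a::alg_closed_field. tri n a b c y z = 0"
    and distinct: "a \<noteq> b" "a \<noteq> c" "b \<noteq> c"
    and degree: "(\<Sum>j<n. b j) = (\<Sum>j<n. a j)" "(\<Sum>j<n. c j) = (\<Sum>j<n. a j)"
    and support: "\<And>j. n \<le> j \<Longrightarrow> a j = 0" "\<And>j. n \<le> j \<Longrightarrow> b j = 0" "\<And>j. n \<le> j \<Longrightarrow> c j = 0"
  obtains u i j k d where "i < n" "j < n" "k < n" "i \<noteq> j" "i \<noteq> k" "j \<noteq> k" "0 < d"
    "a = (\<lambda>l. u l + (if l = i then d else 0))" "b = (\<lambda>l. u l + (if l = j then d else 0))"
    "c = (\<lambda>l. u l + (if l = k then d else 0))" "\<And>t::'a. (1 + t) ^ d = 1 + t ^ d"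
proof -
  \<comment> \<open>The greatest common divisor; no variable divides all three quotients, as the
    locale requires.\<close>
  define u where "u l = min (a l) (min (b l) (c l))" for l
  define a' where "a' l = a l - u l" for l
  define b' where "b' l = b l - u l" for l
  define c' where "c' l = c l - u l" for l
  have eqs: "a = (\<lambda>l. u l + a' l)" "b = (\<lambda>l. u l + b' l)" "c = (\<lambda>l. u l + c' l)"
    by (auto simp: u_def a'_def b'_def c'_def)
  interpret tri_vanishing n a' b' c' "TYPE('a)"
  proof
    show "tri n a' b' c' y z = 0" for y z :: "nat \<Rightarrow> 'a"
      by (rule tri_cancel[of n u]) (use tri eqs in simp)
    show "a' \<noteq> b'" "a' \<noteq> c'" "b' \<noteq> c'" using distinct eqs by auto
    show "(\<Sum>j<n. b' j) = (\<Sum>j<n. a' j)" "(\<Sum>j<n. c' j) = (\<Sum>j<n. a' j)"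
      using degree by (auto simp: eqs sum.distrib)
  qed (use support in \<open>auto simp: u_def a'_def b'_def c'_def min_def\<close>)
  obtain i j k d where "i < n" "j < n" "k < n" "i \<noteq> j" "i \<noteq> k" "j \<noteq> k" "0 < d"
    "a' = (\<lambda>l. if l = i then d else 0)" "b' = (\<lambda>l. if l = j then d else 0)"
    "c' = (\<lambda>l. if l = k then d else 0)" "\<And>t::'a. (1 + t) ^ d = 1 + t ^ d"
    by (rule pure_powers) (rule that)
  then show ?thesis using eqs by (intro that[of i j k d u]) simp_all
qed

text \<open>Comparing derivatives at 0 gives d = 0 in the field unless d = 1, so the characteristic
  is a prime p dividing d. Every element is a p-th power, so the identity descends to d / p.\<close>

lemma additive_power_imp_char_power:
  assumes "0 < d" "\<And>t::'a::alg_closed_field. (1 + t) ^ d = 1 + t ^ d"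
  shows "\<exists>e. d = char_exp TYPE('a) ^ e"
  using assms
proof (induction d rule: less_induct)
  case (less d)
  show ?case
  proof (cases "d = 1")
    case True
    then show ?thesis by (intro exI[of _ 0]) simp
  next
    case False
    define p where "p = CHAR('a)"
    have "[:1, 1:] ^ d - (1 + [:0, 1:] ^ d) = (0 :: 'a poly)"
      by (rule poly_vanish_eq_0) (use less.prems(2) in \<open>simp add: algebra_simps\<close>)
    then have "poly (pderiv ([:1, 1:] ^ d - (1 + [:0, 1:] ^ d))) 0 = (0 :: 'a)" by simp
    then have "of_nat d = (0 :: 'a)"
      using False less.prems(1) by (simp add: pderiv_diff pderiv_add pderiv_power pderiv_pCons zero_power)
    then have pd: "p dvd d" by (simp add: p_def of_nat_eq_0_iff_char_dvd)
    then have "p > 0" using less.prems(1) by (cases p) auto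
    then have p: "prime p" using prime_CHAR_semidom[where ?'a = 'a] by (simp add: p_def)
    obtain d' where d': "d = p * d'" using pd by auto
    have "d' < d" "0 < d'" using d' less.prems(1) prime_gt_1_nat[OF p] by auto
    moreover have "(1 + s) ^ d' = 1 + s ^ d'" for s :: 'a
    proof -
      obtain t where t: "t ^ p = s" using nth_root_exists[of p s] \<open>p > 0\<close> by auto
      have "(1 + t) ^ p = 1 + t ^ p"
        using freshmans_dream[of p 1 t] p by (simp add: p_def)
      then show ?thesis using less.prems(2)[of t] t by (simp add: d' power_mult)
    qed
    ultimately obtain e where "d' = char_exp TYPE('a) ^ e" using less.IH by blast
    then have "d = char_exp TYPE('a) ^ Suc e"
      using d' \<open>p > 0\<close> by (simp add: char_exp_def p_def)
    then show ?thesis by blast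
  qed
qed

section \<open>Families with the minimal number of terms\<close>

definition family :: "nat \<Rightarrow> nat \<Rightarrow> 's set \<Rightarrow> ('s \<Rightarrow> 'a::zero) \<Rightarrow> ('s \<Rightarrow> nat \<Rightarrow> nat \<Rightarrow> nat) \<Rightarrow> bool" where
  "family m n I c \<mu> \<longleftrightarrow> finite I \<and> inj_on \<mu> I \<and> (\<forall>s\<in>I. c s \<noteq> 0)
     \<and> (\<forall>s\<in>I. \<forall>i j. m \<le> i \<or> n \<le> j \<longrightarrow> \<mu> s i j = 0)"

text \<open>The other rows contribute only a factor common to all terms. For a minimal family these
  turn out to be the rows of the minor.\<close>

definition moving_rows :: "'s set \<Rightarrow> ('s \<Rightarrow> nat \<Rightarrow> nat \<Rightarrow> nat) \<Rightarrow> nat set" where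
  "moving_rows I \<mu> = {i. \<exists>s\<in>I. \<exists>s'\<in>I. \<mu> s i \<noteq> \<mu> s' i}"

lemma family_subset: "family m n I c \<mu> \<Longrightarrow> J \<subseteq> I \<Longrightarrow> family m n J c \<mu>"
  unfolding family_def by (meson finite_subset inj_on_subset subsetD)

lemma not_moving: "i \<notin> moving_rows I \<mu> \<Longrightarrow> s \<in> I \<Longrightarrow> s' \<in> I \<Longrightarrow> \<mu> s i = \<mu> s' i"
  unfolding moving_rows_def by blast

lemma moving_rowsI: "s \<in> I \<Longrightarrow> s' \<in> I \<Longrightarrow> \<mu> s i \<noteq> \<mu> s' i \<Longrightarrow> i \<in> moving_rows I \<mu>"
  unfolding moving_rows_def by blast

lemma moving_rowsE:
  assumes "i \<in> moving_rows I \<mu>"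
  obtains s s' where "s \<in> I" "s' \<in> I" "\<mu> s i \<noteq> \<mu> s' i"
  using assms unfolding moving_rows_def by blast

lemma moving_rows_mono: "J \<subseteq> I \<Longrightarrow> moving_rows J \<mu> \<subseteq> moving_rows I \<mu>"
  by (blast intro: moving_rowsI elim: moving_rowsE)

lemma moving_rows_subset: "family m n I c \<mu> \<Longrightarrow> moving_rows I \<mu> \<subseteq> {..<m}"
proof
  fix i assume fam: "family m n I c \<mu>" and "i \<in> moving_rows I \<mu>"
  then obtain s s' where s: "s \<in> I" "s' \<in> I" "\<mu> s i \<noteq> \<mu> s' i" by (elim moving_rowsE)
  show "i \<in> {..<m}"
  proof (rule ccontr)
    assume "i \<notin> {..<m}"
    then have "\<mu> s i j = 0" "\<mu> s' i j = 0" for j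
      using fam s unfolding family_def by (simp_all add: not_less)
    then have "\<mu> s i = \<mu> s' i" by (intro ext) simp
    then show False using s by simp
  qed
qed

lemma finite_moving_rows: "family m n I c \<mu> \<Longrightarrow> finite (moving_rows I \<mu>)"
  by (rule finite_subset[OF moving_rows_subset finite_lessThan])

lemma moving_rows_part:
  assumes "i \<in> moving_rows I \<mu>"
  shows "moving_rows {s\<in>I. \<mu> s i = a} \<mu> \<subset> moving_rows I \<mu>"
proof
  show "moving_rows {s\<in>I. \<mu> s i = a} \<mu> \<subseteq> moving_rows I \<mu>"
    by (rule moving_rows_mono) simp
  have "i \<notin> moving_rows {s\<in>I. \<mu> s i = a} \<mu>" by (simp add: moving_rows_def)
  then show "moving_rows {s\<in>I. \<mu> s i = a} \<mu> \<noteq> moving_rows I \<mu>" using assms by metis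
qed

lemma family_eqI:
  assumes "family m n I c \<mu>" "s \<in> I" "s' \<in> I" "\<And>i. i \<in> moving_rows I \<mu> \<Longrightarrow> \<mu> s i = \<mu> s' i"
  shows "s = s'"
proof -
  have "\<mu> s i = \<mu> s' i" for i
    using assms(4) not_moving[OF _ assms(2,3)] by blast
  then have "\<mu> s = \<mu> s'" by blast
  then show ?thesis using assms(1-3) by (auto simp: family_def inj_on_def)
qed

lemma monev_ones: "monev m n u (mmul (Suc r) (\<lambda>_ k. if k = 0 then 1 else 0) (\<lambda>_ _. 1)) = (1 :: 'a::comm_ring_1)"
  by (simp add: monev_def rmon_def mmul_def)

lemma card_by_row:
  assumes "finite I"
  shows "card I = (\<Sum>a\<in>(\<lambda>s. \<mu> s i) ` I. card {s\<in>I. \<mu> s i = a})"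
  using sum.image_gen[OF assms, of "\<lambda>_. 1::nat" "\<lambda>s. \<mu> s i"] by simp

text \<open>Without a moving row there is only one term, and it is nonzero at the all-ones matrix,
  which has rank 1; hence the rank bound \<open>Suc r\<close>.\<close>

lemma vanishing_all_same_row:
  assumes "vanishing m n (Suc r) I (c :: 's \<Rightarrow> 'a::comm_ring_1) \<mu>" "family m n I c \<mu>" "I \<noteq> {}"
  shows "moving_rows I \<mu> \<noteq> {}"
proof
  assume *: "moving_rows I \<mu> = {}"
  obtain s where s: "s \<in> I" using assms(3) by blast
  then have "I = {s}" using family_eqI[OF assms(2)] * by blast
  then have "c s = 0"
    using vanishingD[OF assms(1), of "\<lambda>_ k. if k = 0 then 1 else 0" "\<lambda>_ _. 1"] by (simp add: monev_ones)
  then show False using s assms(2) by (auto simp: family_def)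
qed

lemma family_support:
  "family m n I c \<mu> \<Longrightarrow> \<forall>s\<in>I. \<forall>j\<ge>n. \<mu> s i j = 0"
  by (auto simp: family_def)

text \<open>If all parts of a row still vanish on rank \<open>Suc r\<close>, a single part already
  has enough terms by the inner induction, as it has fewer moving rows. Otherwise there are at least
  \<open>r + 2\<close> parts, each bounded below by the outer induction.\<close>

theorem vanishing_card_ge:
  fixes c :: "'s \<Rightarrow> 'a::alg_closed_field"
  assumes "vanishing m n r I c \<mu>" "family m n I c \<mu>" "I \<noteq> {}"
  shows "fact (Suc r) \<le> card I"
  using assms
proof (induction r arbitrary: I)
  case 0
  then show ?case by (simp add: family_def Suc_leI card_gt_0_iff)
next
  case (Suc r)
  show ?case using Suc.prems
  proof (induction "card (moving_rows I \<mu>)" arbitrary: I rule: less_induct)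
    case less
    note fam = less.prems(2)
    have fin: "finite I" using fam by (simp add: family_def)
    obtain i where i: "i \<in> moving_rows I \<mu>"
      using vanishing_all_same_row[OF less.prems] by blast
    then have im: "i < m" using moving_rows_subset[OF fam] by auto
    let ?S = "(\<lambda>s. \<mu> s i) ` I" and ?P = "\<lambda>a. {s\<in>I. \<mu> s i = a}"
    have part: "family m n (?P a) c \<mu>" for a by (rule family_subset[OF fam]) auto
    have ne: "?P a \<noteq> {}" if "a \<in> ?S" for a using that by auto
    have pin: "vanishing m n r (?P a) c \<mu>" for a
      by (rule vanishing_pin_row[OF less.prems(1) fin im family_support[OF fam]])
    show ?case
    proof (cases "\<forall>a\<in>?S. vanishing m n (Suc r) (?P a) c \<mu>")
      case True
      obtain a where a: "a \<in> ?S" using less.prems(3) by blast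
      have "card (moving_rows (?P a) \<mu>) < card (moving_rows I \<mu>)"
        by (rule psubset_card_mono[OF finite_moving_rows[OF fam] moving_rows_part[OF i]])
      then have "fact (Suc (Suc r)) \<le> card (?P a)"
        using less.hyps True a part ne by blast
      also have "\<dots> \<le> card I" using fin by (intro card_mono) auto
      finally show ?thesis .
    next
      case False
      then have "\<not> card ?S \<le> Suc r"
        using vanishing_few_rows[OF less.prems(1) fin im family_support[OF fam]] by blast
      then have S: "Suc (Suc r) \<le> card ?S" by simp
      have "fact (Suc (Suc r)) = Suc (Suc r) * fact (Suc r)" by (metis fact_Suc of_nat_id)
      also have "\<dots> \<le> card ?S * fact (Suc r)" using S by (rule mult_right_mono) simp
      also have "\<dots> = (\<Sum>a\<in>?S. fact (Suc r))" by simp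
      also have "\<dots> \<le> (\<Sum>a\<in>?S. card (?P a))"
        by (intro sum_mono Suc.IH pin part ne)
      also have "\<dots> = card I" by (rule card_by_row[OF fin, symmetric])
      finally show ?thesis .
    qed
  qed
qed

section \<open>The case of equality in the lower bound\<close>

lemma double_le_card_of_disjoint:
  assumes "finite I" "A \<subseteq> I" "B \<subseteq> I" "A \<inter> B = {}" "k \<le> card A" "k \<le> card B"
  shows "2 * k \<le> card I"
proof -
  have "card (A \<union> B) = card A + card B"
    using assms finite_subset by (intro card_Un_disjoint) auto
  moreover have "card (A \<union> B) \<le> card I" using assms by (intro card_mono) auto
  ultimately show ?thesis using assms by linarith
qed

text \<open>If every part still vanished on rank \<open>Suc r\<close>, two different parts would
  already contain twice the minimal number of terms. So there are at least \<open>r + 2\<close>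
  parts, and equality of the total forces equality everywhere.\<close>

lemma minimal_row_parts:
  fixes c :: "'s \<Rightarrow> 'a::alg_closed_field"
  assumes van: "vanishing m n (Suc r) I c \<mu>" and fam: "family m n I c \<mu>"
    and card: "card I = fact (Suc (Suc r))" and i: "i \<in> moving_rows I \<mu>"
  shows "card ((\<lambda>s. \<mu> s i) ` I) = Suc (Suc r)"
    and "\<And>a. a \<in> (\<lambda>s. \<mu> s i) ` I \<Longrightarrow> card {s\<in>I. \<mu> s i = a} = fact (Suc r)"
    and "\<exists>a. \<not> vanishing m n (Suc r) {s\<in>I. \<mu> s i = a} c \<mu>"
proof -
  have fin: "finite I" using fam by (simp add: family_def)
  have im: "i < m" using moving_rows_subset[OF fam] i by auto
  let ?S = "(\<lambda>s. \<mu> s i) ` I" and ?P = "\<lambda>a. {s\<in>I. \<mu> s i = a}"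
  have part: "family m n (?P a) c \<mu>" for a by (rule family_subset[OF fam]) auto
  have ne: "?P a \<noteq> {}" if "a \<in> ?S" for a using that by auto
  have pin: "vanishing m n r (?P a) c \<mu>" for a
    by (rule vanishing_pin_row[OF van fin im family_support[OF fam]])
  have ge: "fact (Suc r) \<le> card (?P a)" if "a \<in> ?S" for a
    by (rule vanishing_card_ge[OF pin part ne[OF that]])
  show nv: "\<exists>a. \<not> vanishing m n (Suc r) (?P a) c \<mu>"
  proof (rule ccontr)
    assume all: "\<not> ?thesis"
    obtain s s' where s: "s \<in> I" "s' \<in> I" "\<mu> s i \<noteq> \<mu> s' i" using i by (rule moving_rowsE)
    have "2 * fact (Suc (Suc r)) \<le> card I"
    proof (rule double_le_card_of_disjoint[OF fin])
      show "fact (Suc (Suc r)) \<le> card (?P (\<mu> s i))"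
        by (rule vanishing_card_ge[OF _ part]) (use all s in auto)
      show "fact (Suc (Suc r)) \<le> card (?P (\<mu> s' i))"
        by (rule vanishing_card_ge[OF _ part]) (use all s in auto)
    qed (use s in auto)
    then show False unfolding card using fact_gt_zero[of "Suc (Suc r)", where 'a = nat] by linarith
  qed
  then have S: "Suc (Suc r) \<le> card ?S"
    using vanishing_few_rows[OF van fin im family_support[OF fam]] by (meson not_less_eq_eq)
  have sum: "(\<Sum>a\<in>?S. card (?P a)) = Suc (Suc r) * fact (Suc r)"
    using card_by_row[OF fin, of \<mu> i] card by (metis fact_Suc of_nat_id)
  have "card ?S * fact (Suc r) = (\<Sum>a\<in>?S. fact (Suc r))" by simp
  also have "\<dots> \<le> (\<Sum>a\<in>?S. card (?P a))" by (intro sum_mono ge)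
  finally have "card ?S \<le> Suc (Suc r)"
    unfolding sum by (metis fact_gt_zero mult_le_cancel2)
  then show cS: "card ?S = Suc (Suc r)" using S by simp
  show "card (?P a) = fact (Suc r)" if "a \<in> ?S" for a
  proof -
    have "(\<Sum>a\<in>?S. fact (Suc r)) = (\<Sum>a\<in>?S. card (?P a))" using cS sum by simp
    then show ?thesis
      using sum_mono_inv[of "\<lambda>_. fact (Suc r)" ?S "\<lambda>a. card (?P a)" a] ge that fin by simp
  qed
qed

text \<open>Scaling a row decomposes a vanishing polynomial into its components homogeneous in
  that row, each of which vanishes.\<close>
lemma minimal_row_degree:
  fixes c :: "'s \<Rightarrow> 'a::alg_closed_field"
  assumes van: "vanishing m n r I c \<mu>" and fam: "family m n I c \<mu>"
    and card: "card I = fact (Suc r)" and i: "i < m" and s: "s \<in> I" "s' \<in> I"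
  shows "(\<Sum>j<n. \<mu> s i j) = (\<Sum>j<n. \<mu> s' i j)"
proof (rule ccontr)
  define deg where "deg s = (\<Sum>j<n. \<mu> s i j)" for s
  assume "\<not> ?thesis"
  then have ne: "deg s \<noteq> deg s'" by (simp add: deg_def)
  have fin: "finite I" using fam by (simp add: family_def)
  have van_d: "vanishing m n r {s\<in>I. deg s = d} c \<mu>" for d
    unfolding vanishing_def
  proof (intro allI)
    fix B C :: "nat \<Rightarrow> nat \<Rightarrow> 'a"
    define e where "e s = c s * monev m n (\<mu> s) (mmul r B C)" for s
    have "(\<Sum>s\<in>I. monom (e s) (deg s)) = 0"
    proof (rule poly_vanish_eq_0)
      fix t :: 'a
      define B' where "B' = B(i := \<lambda>k. t * B i k)"
      have "monev m n (\<mu> s) (mmul r B' C) = t ^ deg s * monev m n (\<mu> s) (mmul r B C)" for s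
      proof -
        have 1: "off_row m n i (\<mu> s) (mmul r B' C) = off_row m n i (\<mu> s) (mmul r B C)"
          by (rule off_row_cong) (simp add: mmul_def B'_def)
        have 2: "mmul r B' C i = (\<lambda>j. t * mmul r B C i j)"
          by (simp add: mmul_def B'_def sum_distrib_left mult.assoc)
        show ?thesis
          by (simp add: monev_split[OF i] 1 2 rmon_scale deg_def mult_ac)
      qed
      then have "poly (\<Sum>s\<in>I. monom (e s) (deg s)) t = (\<Sum>s\<in>I. c s * monev m n (\<mu> s) (mmul r B' C))"
        by (simp add: poly_sum poly_monom e_def mult_ac)
      then show "poly (\<Sum>s\<in>I. monom (e s) (deg s)) t = 0"
        using vanishingD[OF van] by simp
    qed
    then have "coeff (\<Sum>s\<in>I. monom (e s) (deg s)) d = 0" by simp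
    then have "(\<Sum>s\<in>I. if deg s = d then e s else 0) = 0" by (simp add: coeff_sum)
    then show "(\<Sum>s\<in>{s\<in>I. deg s = d}. c s * monev m n (\<mu> s) (mmul r B C)) = 0"
      using fin unfolding e_def by (simp only: sum.inter_filter)
  qed
  have ge: "fact (Suc r) \<le> card {t\<in>I. deg t = deg u}" if "u \<in> I" for u
    by (rule vanishing_card_ge[OF van_d family_subset[OF fam]]) (use that in auto)
  \<comment> \<open>Two different degrees would give two disjoint vanishing families, each of at
    least the minimal size.\<close>
  have "2 * fact (Suc r) \<le> card I"
    by (rule double_le_card_of_disjoint[OF fin _ _ _ ge[OF s(1)] ge[OF s(2)]]) (use ne in auto)
  then show False unfolding card using fact_gt_zero[of "Suc r", where 'a = nat] by linarith
qed

text \<open>Stated for an abstract exponent vector \<open>\<rho> s\<close>, so that it describes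
  rows and, after transposition, columns.\<close>

definition row_form :: "nat \<Rightarrow> 's set \<Rightarrow> ('s \<Rightarrow> nat \<Rightarrow> nat) \<Rightarrow> (nat \<Rightarrow> nat) \<Rightarrow> nat \<Rightarrow> ('s \<Rightarrow> nat) \<Rightarrow> bool" where
  "row_form r I \<rho> u q \<sigma> \<longleftrightarrow> 0 < q \<and> (\<forall>s\<in>I. \<rho> s = (\<lambda>j. u j + (if j = \<sigma> s then q else 0)))
     \<and> card (\<sigma> ` I) = Suc r"

text \<open>Two distinct monomials of this kind determine \<open>u\<close> as their greatest common
  divisor.\<close>

lemma row_form_unique:
  assumes "(\<lambda>l::nat. u l + (if l = i then d else 0)) = (\<lambda>l. u' l + (if l = i' then d' else 0))"
    and "(\<lambda>l. u l + (if l = j then d else 0)) = (\<lambda>l. u' l + (if l = j' then d' else 0))"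
    and "i \<noteq> j" "i' \<noteq> j'" "0 < (d :: nat)"
  shows "u = u'" "d = d'"
proof -
  have "u l = min (u l + (if l = i then d else 0)) (u l + (if l = j then d else 0))" for l
    using assms(3) by auto
  also have "\<dots> l = min (u' l + (if l = i' then d' else 0)) (u' l + (if l = j' then d' else 0))" for l
    using fun_cong[OF assms(1), of l] fun_cong[OF assms(2), of l] by simp
  also have "\<dots> l = u' l" for l using assms(4) by auto
  finally show u: "u = u'" by blast
  show "d = d'" using fun_cong[OF assms(1), of i] assms(5) u by (simp split: if_splits)
qed

text \<open>The shape is known for each triple of row monomials. Two fixed monomials
  \<open>x\<close>, \<open>y\<close> determine the common divisor and the exponent, so the triples
  formed with every third monomial share them.\<close>

lemma minimal_row_form:
  fixes c :: "'s \<Rightarrow> 'a::alg_closed_field"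
  assumes van: "vanishing m n r I c \<mu>" and fam: "family m n I c \<mu>" and r: "2 \<le> r"
    and card: "card I = fact (Suc r)" and i: "i \<in> moving_rows I \<mu>"
  shows "\<exists>u q \<sigma>. row_form r I (\<lambda>s. \<mu> s i) u q \<sigma> \<and> (\<exists>e. q = char_exp TYPE('a) ^ e)"
proof -
  obtain r' where r': "r = Suc r'" using r by (cases r) auto
  have fin: "finite I" using fam by (simp add: family_def)
  have im: "i < m" using moving_rows_subset[OF fam] i by auto
  let ?S = "(\<lambda>s. \<mu> s i) ` I"
  have cS: "card ?S = Suc r"
    using minimal_row_parts(1)[of m n r' I c \<mu> i] van fam card i r' by simp
  obtain a0 where a0: "\<not> vanishing m n r {s\<in>I. \<mu> s i = a0} c \<mu>"
    using minimal_row_parts(3)[of m n r' I c \<mu> i] van fam card i r' by auto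
  have shape: "\<exists>u i j k d. i \<noteq> j \<and> i \<noteq> k \<and> j \<noteq> k \<and> 0 < d \<and>
      x = (\<lambda>l. u l + (if l = i then d else 0)) \<and> y = (\<lambda>l. u l + (if l = j then d else 0)) \<and>
      z = (\<lambda>l. u l + (if l = k then d else 0)) \<and> (\<forall>t::'a. (1 + t) ^ d = 1 + t ^ d)"
    if xyz: "x \<in> ?S" "y \<in> ?S" "z \<in> ?S" "x \<noteq> y" "x \<noteq> z" "y \<noteq> z" for x y z
  proof -
    have tri: "tri n x y z (v :: nat \<Rightarrow> 'a) w = 0" for v w
      by (rule vanishing_tri[OF van fin im family_support[OF fam] r cS a0 xyz])
    have deg: "(\<Sum>j<n. y j) = (\<Sum>j<n. x j)" "(\<Sum>j<n. z j) = (\<Sum>j<n. x j)"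
      using xyz minimal_row_degree[OF van fam card im] by auto
    have sup: "v j = 0" if "v \<in> ?S" "n \<le> j" for v j
      using family_support[OF fam, of i] that by auto
    show ?thesis
      by (rule tri_zero_shape[OF tri xyz(4-6) deg sup[OF xyz(1)] sup[OF xyz(2)] sup[OF xyz(3)]]) blast+
  qed
  obtain S' where S': "S' \<subseteq> ?S" "card S' = 3"
    using obtain_subset_with_card_n[of 3 ?S] cS r by auto
  then obtain x y z where xyz: "S' = {x, y, z}" "x \<noteq> y" "x \<noteq> z" "y \<noteq> z"
    by (auto simp: card_3_iff)
  then have xyzS: "x \<in> ?S" "y \<in> ?S" "z \<in> ?S" using S' by auto
  obtain u p k d where upk: "p \<noteq> k" "0 < d"
    "x = (\<lambda>l. u l + (if l = p then d else 0))" "y = (\<lambda>l. u l + (if l = k then d else 0))"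
    "\<forall>t::'a. (1 + t) ^ d = 1 + t ^ d"
    using shape[OF xyzS xyz(2-4)] by blast
  have "\<exists>k. v = (\<lambda>l. u l + (if l = k then d else 0))" if "v \<in> ?S" for v
  proof (cases "v = x \<or> v = y")
    case True
    then show ?thesis using upk by blast
  next
    case False
    then have ne: "x \<noteq> v" "y \<noteq> v" by auto
    obtain u' p' k' l' d' where 1: "p' \<noteq> k'" "0 < d'"
      "x = (\<lambda>l. u' l + (if l = p' then d' else 0))" "y = (\<lambda>l. u' l + (if l = k' then d' else 0))"
      "v = (\<lambda>l. u' l + (if l = l' then d' else 0))"
      using shape[OF xyzS(1,2) \<open>v \<in> ?S\<close> xyz(2) ne] by blast
    have "u = u'" "d = d'"
      using row_form_unique[OF trans[OF upk(3)[symmetric] 1(3)] trans[OF upk(4)[symmetric] 1(4)] upk(1) 1(1) upk(2)]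
      by auto
    then show ?thesis using 1 by blast
  qed
  then have "\<forall>s\<in>I. \<exists>k. \<mu> s i = (\<lambda>l. u l + (if l = k then d else 0))" by blast
  then obtain \<sigma> where \<sigma>: "\<forall>s\<in>I. \<mu> s i = (\<lambda>l. u l + (if l = \<sigma> s then d else 0))" by metis
  define f where "f k = (\<lambda>l. u l + (if l = k then d else 0))" for k
  have "inj f"
  proof
    fix k k' assume "f k = f k'"
    then have "f k k = f k' k" by simp
    then show "k = k'" using upk(2) by (simp add: f_def split: if_splits)
  qed
  have "?S = f ` \<sigma> ` I" using \<sigma> by (auto simp: f_def image_image)
  then have "card (\<sigma> ` I) = Suc r"
    using cS card_image[OF inj_on_subset[OF \<open>inj f\<close>], of "\<sigma> ` I"] by simp
  moreover obtain e where "d = char_exp TYPE('a) ^ e"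
    using additive_power_imp_char_power[OF upk(2)] upk(5) by blast
  ultimately show ?thesis using \<sigma> upk(2) unfolding row_form_def by blast
qed

section \<open>Transposition and division by a common monomial\<close>

lemma monev_transpose: "monev m n \<mu> X = monev n m (\<lambda>i j. \<mu> j i) (\<lambda>i j. X j i)"
  unfolding monev_def rmon_def by (rule prod.swap)

lemma vanishing_transpose:
  assumes "vanishing m n r I c \<mu>"
  shows "vanishing n m r I c (\<lambda>s i j. \<mu> s j i)"
  unfolding vanishing_def
proof (intro allI)
  fix B C :: "nat \<Rightarrow> nat \<Rightarrow> 'b"
  have "(\<lambda>i j. mmul r B C j i) = mmul r (\<lambda>i k. C k i) (\<lambda>k j. B j k)"
    by (simp add: mmul_def mult.commute)
  then show "(\<Sum>s\<in>I. c s * monev n m (\<lambda>i j. \<mu> s j i) (mmul r B C)) = 0"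
    using vanishingD[OF assms, of "\<lambda>i k. C k i" "\<lambda>k j. B j k"]
    by (simp add: monev_transpose[of n m _ "mmul r B C"])
qed

lemma family_transpose:
  assumes "family m n I c \<mu>"
  shows "family n m I c (\<lambda>s i j. \<mu> s j i)"
proof -
  have "inj_on (\<lambda>s i j. \<mu> s j i) I"
  proof
    fix s t assume st: "s \<in> I" "t \<in> I" "(\<lambda>i j. \<mu> s j i) = (\<lambda>i j. \<mu> t j i)"
    then have "\<mu> s = \<mu> t" by (intro ext) metis
    then show "s = t" using assms st by (auto simp: family_def inj_on_def)
  qed
  then show ?thesis using assms by (auto simp: family_def)
qed

lemma vanishing_divide:
  fixes c :: "'s \<Rightarrow> 'a::alg_closed_field"
  assumes "vanishing m n (Suc r) I c \<mu>" "\<And>s. s \<in> I \<Longrightarrow> \<mu> s = (\<lambda>i j. u i j + \<nu> s i j)"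
  shows "vanishing m n (Suc r) I c \<nu>"
proof -
  have "(\<forall>B C. monev m n u (mmul (Suc r) B C) = (0 :: 'a))
      \<or> (\<forall>B C. (\<Sum>s\<in>I. c s * monev m n (\<nu> s) (mmul (Suc r) B C)) = 0)"
  proof (rule line_poly_mult_eq_0_pair[where F = "\<lambda>B C. monev m n u (mmul (Suc r) B C)"
        and G = "\<lambda>B C. \<Sum>s\<in>I. c s * monev m n (\<nu> s) (mmul (Suc r) B C)"])
    fix B C :: "nat \<Rightarrow> nat \<Rightarrow> 'a"
    have "(\<Sum>s\<in>I. c s * monev m n (\<mu> s) (mmul (Suc r) B C))
        = monev m n u (mmul (Suc r) B C) * (\<Sum>s\<in>I. c s * monev m n (\<nu> s) (mmul (Suc r) B C))"
      unfolding sum_distrib_left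
      by (intro sum.cong) (simp_all add: assms(2) monev_add mult_ac)
    then show "monev m n u (mmul (Suc r) B C) * (\<Sum>s\<in>I. c s * monev m n (\<nu> s) (mmul (Suc r) B C)) = 0"
      using vanishingD[OF assms(1)] by simp
  qed (intro line_poly_sum line_poly_mult line_poly_monev line_poly_mmul line_poly_const line_poly_var)+
  moreover have "\<not> (\<forall>B C. monev m n u (mmul (Suc r) B C) = (0 :: 'a))"
    using monev_ones zero_neq_one by metis
  ultimately show ?thesis by (simp add: vanishing_def)
qed

section \<open>Permutations\<close>

text \<open>The exponent at (\<open>i\<close>, \<open>\<sigma> s\<close>) exceeds by
  \<open>q\<close> its value in some other member, because \<open>\<sigma>\<close> is not constant.
  Read along the column, the same jump must be that of the column form.\<close>

lemma row_column_match:
  assumes row: "row_form r I (\<lambda>s. \<mu> s i) u q \<sigma>"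
    and col: "\<And>j. j \<in> J \<Longrightarrow> row_form r I (\<lambda>s i. \<mu> s i j) (v j) (p j) (\<tau> j)"
    and J: "J = moving_rows I (\<lambda>s i j. \<mu> s j i)" and r: "0 < r" and s: "s \<in> I"
  shows "\<sigma> s \<in> J" "\<tau> (\<sigma> s) s = i" "p (\<sigma> s) = q"
proof -
  define j where "j = \<sigma> s"
  have "\<exists>s'\<in>I. \<sigma> s' \<noteq> j"
  proof (rule ccontr)
    assume "\<not> ?thesis"
    then have "\<sigma> ` I \<subseteq> {j}" by auto
    then have "card (\<sigma> ` I) \<le> 1" by (metis card_mono finite.emptyI finite_insert is_singleton_altdef is_singletonI)
    then show False using row r by (simp add: row_form_def)
  qed
  then obtain s' where s': "s' \<in> I" "\<sigma> s' \<noteq> j" by blast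
  have q: "0 < q" using row by (simp add: row_form_def)
  have 1: "\<mu> s i j = u j + q" "\<mu> s' i j = u j"
    using row s s' by (auto simp: row_form_def j_def)
  show jJ: "\<sigma> s \<in> J"
    unfolding J
  proof (rule moving_rowsI[OF s s'(1)])
    show "(\<lambda>i. \<mu> s i (\<sigma> s)) \<noteq> (\<lambda>i. \<mu> s' i (\<sigma> s))"
    proof
      assume "(\<lambda>i. \<mu> s i (\<sigma> s)) = (\<lambda>i. \<mu> s' i (\<sigma> s))"
      then have "\<mu> s i j = \<mu> s' i j" unfolding j_def by (rule fun_cong)
      then show False using 1 q by simp
    qed
  qed
  have col_j: "row_form r I (\<lambda>s i. \<mu> s i j) (v j) (p j) (\<tau> j)"
    using col[OF jJ] by (simp add: j_def)
  have e: "\<mu> t i j = v j i + (if i = \<tau> j t then p j else 0)" if "t \<in> I" for t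
    using col_j that by (auto simp: row_form_def dest!: bspec fun_cong[of _ _ i])
  have "\<tau> j s = i \<and> p j = q"
    using e[OF s] e[OF s'(1)] 1 q by (auto split: if_splits)
  then show "\<tau> (\<sigma> s) s = i" "p (\<sigma> s) = q" by (simp_all add: j_def)
qed

text \<open>A minimal vanishing family, up to a common monomial: \<open>\<sigma> s\<close> is the partial permutation
  on which the \<open>s\<close>-th monomial is supported.\<close>
locale perm_family =
  fixes r :: nat and I :: "'s set" and c :: "'s \<Rightarrow> 'a::field" and R R' :: "nat set" and \<sigma> :: "'s \<Rightarrow> nat \<Rightarrow> nat"
  assumes fin: "finite I" "finite R" and nz: "s \<in> I \<Longrightarrow> c s \<noteq> 0"
    and card_I: "card I = fact (Suc r)"
    and bij: "s \<in> I \<Longrightarrow> bij_betw (\<sigma> s) R R'"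
    and ext: "s \<in> I \<Longrightarrow> s' \<in> I \<Longrightarrow> (\<And>i. i \<in> R \<Longrightarrow> \<sigma> s i = \<sigma> s' i) \<Longrightarrow> s = s'"
    and choices: "i \<in> R \<Longrightarrow> card ((\<lambda>s. \<sigma> s i) ` I) = Suc r"
    and part: "i \<in> R \<Longrightarrow> s0 \<in> I \<Longrightarrow> card {s\<in>I. \<sigma> s i = \<sigma> s0 i} = fact r"
    and colour: "\<And>k l. (\<And>i. i \<in> R \<Longrightarrow> k i < r) \<Longrightarrow> (\<Sum>s\<in>{s\<in>I. \<forall>i\<in>R. l (\<sigma> s i) = k i}. c s) = 0"

text \<open>The product is the 0-1 matrix with entry 1 where the colour \<open>k i\<close> of the
  row equals the colour \<open>l j\<close> of the column. It has rank at most \<open>r\<close>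
  because only \<open>r\<close> colours count.\<close>

lemma monev_permutation:
  assumes i: "\<And>i. i \<in> R \<Longrightarrow> i < m" and j: "\<And>i. i \<in> R \<Longrightarrow> \<sigma> i < n" and q: "\<And>i. i \<in> R \<Longrightarrow> 0 < q i"
    and k: "\<And>i. i \<in> R \<Longrightarrow> k i < r"
  shows "monev m n (\<lambda>i j. if i \<in> R \<and> j = \<sigma> i then q i else 0)
      (mmul r (\<lambda>i x. of_bool (k i = x)) (\<lambda>x j. of_bool (l j = x)))
    = (of_bool (\<forall>i\<in>R. l (\<sigma> i) = k i) :: 'a::idom)"
proof -
  have row: "rmon n (\<lambda>j. if i \<in> R \<and> j = \<sigma> i then q i else 0)
      (mmul r (\<lambda>i x. of_bool (k i = x)) (\<lambda>x j. of_bool (l j = x)) i)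
    = (if i \<in> R then of_bool (l (\<sigma> i) = k i) else (1 :: 'a))" for i
  proof (cases "i \<in> R")
    case True
    have "mmul r (\<lambda>i x. of_bool (k i = x)) (\<lambda>x j. of_bool (l j = x)) i (\<sigma> i)
        = (\<Sum>x<r. if x = k i then of_bool (l (\<sigma> i) = k i) else (0 :: 'a))"
      unfolding mmul_def by (intro sum.cong) auto
    also have "\<dots> = of_bool (l (\<sigma> i) = k i)" using k[OF True] by simp
    finally show ?thesis
      using True by (subst rmon_at[OF j[OF True]]) (simp_all add: q)
  qed (simp add: rmon_def)
  have "monev m n (\<lambda>i j. if i \<in> R \<and> j = \<sigma> i then q i else 0)
      (mmul r (\<lambda>i x. of_bool (k i = x)) (\<lambda>x j. of_bool (l j = x)))
    = (\<Prod>i<m. if i \<in> R then of_bool (l (\<sigma> i) = k i) else (1 :: 'a))"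
    unfolding monev_def row ..
  also have "\<dots> = of_bool (\<forall>i\<in>R. l (\<sigma> i) = k i)"
  proof (cases "\<forall>i\<in>R. l (\<sigma> i) = k i")
    case False
    then obtain i0 where "i0 \<in> R" "l (\<sigma> i0) \<noteq> k i0" by blast
    then have "(\<Prod>i<m. if i \<in> R then of_bool (l (\<sigma> i) = k i) else (1 :: 'a)) = 0"
      using i by (intro prod_zero) (auto intro!: bexI[of _ i0])
    then show ?thesis using False by simp
  qed (simp add: prod.neutral)
  finally show ?thesis .
qed

text \<open>The choices made in rows and in columns are mutually inverse, so every term is a
  bijection from \<open>R\<close> to \<open>R'\<close>. Recording \<open>q i\<close> as a function
  \<open>q'\<close> of the column later shows that all exponents agree.\<close>

lemma minimal_family_shape:
  fixes c :: "'s \<Rightarrow> 'a::alg_closed_field"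
  assumes van: "vanishing m n r I c \<mu>" and fam: "family m n I c \<mu>" and r: "2 \<le> r"
    and card: "card I = fact (Suc r)"
  defines "R \<equiv> moving_rows I \<mu>" and "R' \<equiv> moving_rows I (\<lambda>s i j. \<mu> s j i)"
  shows "\<exists>U q q' \<sigma>. perm_family r I c R R' \<sigma>
     \<and> (\<forall>s\<in>I. \<mu> s = (\<lambda>i j. U i j + (if i \<in> R \<and> j = \<sigma> s i then q i else 0)))
     \<and> (\<forall>i\<in>R. 0 < q i \<and> (\<exists>e. q i = char_exp TYPE('a) ^ e) \<and> (\<forall>s\<in>I. q i = q' (\<sigma> s i)))"
proof -
  have fin: "finite I" using fam by (simp add: family_def)
  have "\<forall>i\<in>R. \<exists>u q \<sigma>. row_form r I (\<lambda>s. \<mu> s i) u q \<sigma> \<and> (\<exists>e. q = char_exp TYPE('a) ^ e)"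
    unfolding R_def using minimal_row_form[OF van fam r card] by blast
  then obtain u q \<sigma> where row: "\<And>i. i \<in> R \<Longrightarrow> row_form r I (\<lambda>s. \<mu> s i) (u i) (q i) (\<sigma> i)"
    and pow: "\<And>i. i \<in> R \<Longrightarrow> \<exists>e. q i = char_exp TYPE('a) ^ e"
    by metis
  have "\<forall>j\<in>R'. \<exists>v p \<tau>. row_form r I (\<lambda>s i. \<mu> s i j) v p \<tau>"
    unfolding R'_def
    using minimal_row_form[OF vanishing_transpose[OF van] family_transpose[OF fam] r card] by blast
  then obtain v p \<tau> where col: "\<And>j. j \<in> R' \<Longrightarrow> row_form r I (\<lambda>s i. \<mu> s i j) (v j) (p j) (\<tau> j)"
    by metis
  have r0: "0 < r" using r by simp
  have fwd: "\<sigma> i s \<in> R'" "\<tau> (\<sigma> i s) s = i" "p (\<sigma> i s) = q i" if "i \<in> R" "s \<in> I" for i s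
    using row_column_match[OF row[OF that(1)] col meta_eq_to_obj_eq[OF R'_def] r0 that(2)] by auto
  have bwd: "\<tau> j s \<in> R" "\<sigma> (\<tau> j s) s = j" if "j \<in> R'" "s \<in> I" for j s
    using row_column_match[of r I "\<lambda>s i j. \<mu> s j i", OF col[OF that(1)] row meta_eq_to_obj_eq[OF R_def] r0 that(2)] by auto
  have q0: "0 < q i" if "i \<in> R" for i using row[OF that] by (simp add: row_form_def)
  have ne: "I \<noteq> {}" using card by auto
  then obtain s1 where s1: "s1 \<in> I" by blast
  \<comment> \<open>Outside \<open>R\<close> all members have the same exponents, so any
    \<open>s1\<close> can supply them.\<close>
  define U where "U i = (if i \<in> R then u i else \<mu> s1 i)" for i
  have shape: "\<mu> s = (\<lambda>i j. U i j + (if i \<in> R \<and> j = \<sigma> i s then q i else 0))" if "s \<in> I" for s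
  proof (rule ext)
    fix i
    show "\<mu> s i = (\<lambda>j. U i j + (if i \<in> R \<and> j = \<sigma> i s then q i else 0))"
    proof (cases "i \<in> R")
      case True
      then show ?thesis using row[OF True] that by (auto simp: row_form_def U_def)
    next
      case False
      then show ?thesis using not_moving[of i I \<mu> s s1] that s1 by (auto simp: R_def U_def)
    qed
  qed
  have eq_iff: "\<mu> s i = \<mu> s' i \<longleftrightarrow> \<sigma> i s = \<sigma> i s'" if "i \<in> R" "s \<in> I" "s' \<in> I" for i s s'
  proof
    assume "\<mu> s i = \<mu> s' i"
    then have "\<mu> s i (\<sigma> i s) = \<mu> s' i (\<sigma> i s)" by simp
    then show "\<sigma> i s = \<sigma> i s'"
      using shape[OF that(2)] shape[OF that(3)] that(1) q0[OF that(1)] by (simp split: if_splits)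
  next
    assume "\<sigma> i s = \<sigma> i s'"
    then show "\<mu> s i = \<mu> s' i" using shape[OF that(2)] shape[OF that(3)] by simp
  qed
  obtain r' where r': "r = Suc r'" using r by (cases r) auto
  have Rm: "i < m" if "i \<in> R" for i using moving_rows_subset[OF fam] that by (auto simp: R_def)
  have Rn: "j < n" if "j \<in> R'" for j
    using moving_rows_subset[OF family_transpose[OF fam]] that by (auto simp: R'_def)
  have "perm_family r I c R R' (\<lambda>s i. \<sigma> i s)"
  proof
    show "finite I" by (rule fin)
    show "finite R" unfolding R_def by (rule finite_moving_rows[OF fam])
    show "card I = fact (Suc r)" by (rule card)
    show "c s \<noteq> 0" if "s \<in> I" for s using fam that by (simp add: family_def)
    show "bij_betw (\<lambda>i. \<sigma> i s) R R'" if "s \<in> I" for s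
      by (rule bij_betw_byWitness[where f' = "\<lambda>j. \<tau> j s"]) (use fwd bwd that in auto)
    show "s = s'" if "s \<in> I" "s' \<in> I" "\<And>i. i \<in> R \<Longrightarrow> \<sigma> i s = \<sigma> i s'" for s s'
      by (rule family_eqI[OF fam that(1,2)]) (use eq_iff that in \<open>simp add: R_def\<close>)
    show "card ((\<lambda>s. \<sigma> i s) ` I) = Suc r" if "i \<in> R" for i
      using row[OF that] by (simp add: row_form_def)
    show "card {s\<in>I. \<sigma> i s = \<sigma> i s0} = fact r" if "i \<in> R" "s0 \<in> I" for i s0
    proof -
      have "{s\<in>I. \<sigma> i s = \<sigma> i s0} = {s\<in>I. \<mu> s i = \<mu> s0 i}" using eq_iff that by auto
      then show ?thesis
        using minimal_row_parts(2)[of m n r' I c \<mu> i "\<mu> s0 i"] van fam card that r' by (simp add: R_def)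
    qed
    show "(\<Sum>s\<in>{s\<in>I. \<forall>i\<in>R. l (\<sigma> i s) = k i}. c s) = 0" if k: "\<And>i. i \<in> R \<Longrightarrow> k i < r" for k l :: "nat \<Rightarrow> nat"
    proof -
      \<comment> \<open>The common monomial is divided out first, as it may vanish at the 0-1
        matrix.\<close>
      define \<nu> where "\<nu> s = (\<lambda>i j. if i \<in> R \<and> j = \<sigma> i s then q i else 0)" for s
      have "vanishing m n (Suc r') I c \<nu>"
        by (rule vanishing_divide[of m n r' I c \<mu> U]) (use van r' shape in \<open>auto simp: \<nu>_def\<close>)
      then have "0 = (\<Sum>s\<in>I. c s * monev m n (\<nu> s) (mmul r (\<lambda>i x. of_bool (k i = x)) (\<lambda>x j. of_bool (l j = x))))"
        unfolding r' by (rule vanishingD[symmetric])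
      also have "\<dots> = (\<Sum>s\<in>I. if \<forall>i\<in>R. l (\<sigma> i s) = k i then c s else 0)"
      proof (rule sum.cong[OF refl])
        fix s assume s: "s \<in> I"
        have "monev m n (\<nu> s) (mmul r (\<lambda>i x. of_bool (k i = x)) (\<lambda>x j. of_bool (l j = x)))
            = (of_bool (\<forall>i\<in>R. l (\<sigma> i s) = k i) :: 'a)"
          unfolding \<nu>_def by (rule monev_permutation) (use Rm Rn fwd s q0 k in auto)
        then show "c s * monev m n (\<nu> s) (mmul r (\<lambda>i x. of_bool (k i = x)) (\<lambda>x j. of_bool (l j = x)))
            = (if \<forall>i\<in>R. l (\<sigma> i s) = k i then c s else 0)" by simp
      qed
      also have "\<dots> = (\<Sum>s\<in>{s\<in>I. \<forall>i\<in>R. l (\<sigma> i s) = k i}. c s)"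
        using fin by (rule sum.inter_filter[symmetric])
      finally show ?thesis by simp
    qed
  qed
  moreover have "\<forall>i\<in>R. 0 < q i \<and> (\<exists>e. q i = char_exp TYPE('a) ^ e) \<and> (\<forall>s\<in>I. q i = p (\<sigma> i s))"
    using q0 pow fwd by simp
  ultimately show ?thesis
    using shape by (intro exI[of _ U] exI[of _ q] exI[of _ p] exI[of _ "\<lambda>s i. \<sigma> i s"]) blast
qed

section \<open>All bijections occur, with alternating signs\<close>

context perm_family
begin

lemma I_nonempty: "I \<noteq> {}"
  using card_I by auto

lemma card_R': "card R' = card R"
  using I_nonempty bij bij_betw_same_card by (metis ex_in_conv)

lemma finite_R': "finite R'"
  using I_nonempty bij bij_betw_finite fin(2) by (metis ex_in_conv)

lemma choices_subset: "i \<in> R \<Longrightarrow> (\<lambda>s. \<sigma> s i) ` I \<subseteq> R'"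
  using bij by (auto dest: bij_betwE)

lemma card_R_ge: "R \<noteq> {} \<Longrightarrow> Suc r \<le> card R"
  using choices choices_subset card_mono[OF finite_R'] card_R' by (metis ex_in_conv)

lemma inj: "s \<in> I \<Longrightarrow> i \<in> R \<Longrightarrow> j \<in> R \<Longrightarrow> \<sigma> s i = \<sigma> s j \<longleftrightarrow> i = j"
  using bij by (metis bij_betw_imp_inj_on inj_on_eq_iff)

text \<open>The members are (r + 1)! distinct bijections between sets of size r + 1, so none is
  missing. Composition with the inverse of one member \<open>s0\<close> turns bijections into
  permutations of \<open>R\<close>.\<close>

lemma all_bijections:
  assumes "card R = Suc r" "bij_betw f R R'"
  shows "\<exists>s\<in>I. \<forall>i\<in>R. \<sigma> s i = f i"
proof -
  obtain s0 where s0: "s0 \<in> I" using I_nonempty by blast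
  define h where "h g i = (if i \<in> R then inv_into R (\<sigma> s0) (g i) else i)" for g i
  have h_perm: "h g permutes R" if "bij_betw g R R'" for g
  proof -
    have "bij_betw (inv_into R (\<sigma> s0) \<circ> g) R R"
      using that bij_betw_inv_into[OF bij[OF s0]] by (rule bij_betw_trans)
    then have "bij_betw (h g) R R" by (rule bij_betw_cong[THEN iffD1, rotated]) (simp add: h_def)
    then show ?thesis by (rule bij_imp_permutes) (simp add: h_def)
  qed
  have h_inv: "\<sigma> s0 (h g i) = g i" if "bij_betw g R R'" "i \<in> R" for g i
    using that bij_betw_inv_into_right[OF bij[OF s0]] bij_betwE[OF that(1)] by (simp add: h_def)
  have "inj_on (\<lambda>s. h (\<sigma> s)) I"
  proof
    fix s t assume st: "s \<in> I" "t \<in> I" "h (\<sigma> s) = h (\<sigma> t)"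
    show "s = t" by (rule ext[OF st(1,2)]) (metis h_inv bij st)
  qed
  then have "card ((\<lambda>s. h (\<sigma> s)) ` I) = card {p. p permutes R}"
    using card_image card_I card_permutations[OF assms(1) fin(2)] by fastforce
  then have "(\<lambda>s. h (\<sigma> s)) ` I = {p. p permutes R}"
    using h_perm bij by (intro card_subset_eq finite_permutations fin) auto
  then obtain s where s: "s \<in> I" "h (\<sigma> s) = h f" using h_perm[OF assms(2)] by (metis (no_types, lifting) imageE mem_Collect_eq)
  then have "\<sigma> s i = f i" if "i \<in> R" for i
    by (metis h_inv bij assms(2) that)
  then show ?thesis using s(1) by blast
qed

text \<open>Give \<open>a\<close> and \<open>b\<close> the same colour and all other rows distinct
  ones, which takes exactly \<open>r\<close> colours, and colour the columns through
  \<open>\<sigma> s\<close>. Only \<open>s\<close> and \<open>s'\<close> respect the colouring, so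
  their coefficients cancel.\<close>

lemma swap_sign:
  assumes card_R: "card R = Suc r" and s: "s \<in> I" "s' \<in> I" and ab: "a \<in> R" "b \<in> R" "a \<noteq> b"
    and swap: "\<sigma> s' a = \<sigma> s b" "\<sigma> s' b = \<sigma> s a" "\<And>i. i \<in> R \<Longrightarrow> i \<noteq> a \<Longrightarrow> i \<noteq> b \<Longrightarrow> \<sigma> s' i = \<sigma> s i"
  shows "c s' = - c s"
proof -
  have "card (R - {b}) = r" using card_R ab fin by simp
  then obtain e where e: "bij_betw e (R - {b}) {..<r}"
    using ex_bij_betw_finite_nat[of "R - {b}"] fin by (auto simp: atLeast0LessThan)
  define k where "k x = (if x = b then e a else e x)" for x
  define l where "l y = k (inv_into R (\<sigma> s) y)" for y
  have e_less: "e x < r" if "x \<in> R" "x \<noteq> b" for x using bij_betwE[OF e] that by auto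
  have e_inj: "e x = e y \<longleftrightarrow> x = y" if "x \<in> R - {b}" "y \<in> R - {b}" for x y
    using bij_betw_imp_inj_on[OF e] that by (rule inj_on_eq_iff)
  have l_\<sigma>: "l (\<sigma> s x) = k x" if "x \<in> R" for x
    using bij_betw_inv_into_left[OF bij[OF s(1)] that] by (simp add: l_def)
  have k_eq: "k x = k y \<longleftrightarrow> x = y \<or> {x, y} = {a, b}" if "x \<in> R" "y \<in> R" for x y
    using that ab e_inj[of x y] e_inj[of a y] e_inj[of x a] by (auto simp: k_def doubleton_eq_iff)
  have "{t\<in>I. \<forall>x\<in>R. l (\<sigma> t x) = k x} = {s, s'}" (is "?A = _")
  proof
    have "l (\<sigma> s' x) = k x" if "x \<in> R" for x
      using that ab swap l_\<sigma> by (cases "x = a"; cases "x = b") (auto simp: k_def)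
    then show "{s, s'} \<subseteq> ?A" using s l_\<sigma> by auto
    show "?A \<subseteq> {s, s'}"
    proof
      fix t assume "t \<in> ?A"
      then have t: "t \<in> I" "\<And>x. x \<in> R \<Longrightarrow> l (\<sigma> t x) = k x" by auto
      have alt: "\<sigma> t x = \<sigma> s x \<or> (\<exists>y\<in>R. \<sigma> t x = \<sigma> s y \<and> {x, y} = {a, b})" if x: "x \<in> R" for x
      proof -
        have "\<sigma> t x \<in> \<sigma> s ` R" using bij[OF t(1)] bij[OF s(1)] x by (auto simp: bij_betw_def)
        then obtain y where y: "y \<in> R" "\<sigma> t x = \<sigma> s y" by blast
        then have "k y = k x" using t(2)[OF x] l_\<sigma> by simp
        then show ?thesis using k_eq[OF y(1) x] y by (metis insert_commute)
      qed
      have other: "\<sigma> t x = \<sigma> s x" if "x \<in> R" "x \<noteq> a" "x \<noteq> b" for x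
        using alt[OF that(1)] that by (auto simp: doubleton_eq_iff)
      have a: "\<sigma> t a = \<sigma> s a \<or> \<sigma> t a = \<sigma> s b" and b: "\<sigma> t b = \<sigma> s b \<or> \<sigma> t b = \<sigma> s a"
        using alt[OF ab(1)] alt[OF ab(2)] ab(3) by (auto simp: doubleton_eq_iff)
      show "t \<in> {s, s'}"
      proof (cases "\<sigma> t a = \<sigma> s a")
        case True
        then have "\<sigma> t b = \<sigma> s b" using b inj[OF t(1) ab(1,2)] ab(3) by metis
        then have "t = s" using True other by (intro ext t s) metis
        then show ?thesis by simp
      next
        case False
        then have ta: "\<sigma> t a = \<sigma> s b" using a by simp
        then have "\<sigma> t b = \<sigma> s a" using b inj[OF t(1) ab(1,2)] ab(3) by metis
        then have "t = s'" using ta other swap by (intro ext t s) metis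
        then show ?thesis by simp
      qed
    qed
  qed
  moreover have "s \<noteq> s'" using swap(1) inj[OF s(1) ab(1,2)] ab(3) by metis
  moreover have "(\<Sum>t\<in>?A. c t) = 0"
    by (rule colour) (use e_less ab in \<open>auto simp: k_def\<close>)
  ultimately show ?thesis by (simp add: eq_neg_iff_add_eq_0 add.commute)
qed

end

section \<open>The number of permuted rows\<close>

context perm_family
begin

text \<open>Use one colour for \<open>i\<close>, \<open>j\<close> and their images and a second for
  everything else. The coefficients of the members respecting it sum to zero and \<open>s0\<close>
  contributes a nonzero one, so a second member does too.\<close>

lemma pair_stable:
  assumes r: "2 \<le> r" and s0: "s0 \<in> I" and ij: "i \<in> R" "j \<in> R" "i \<noteq> j"
  shows "\<exists>s\<in>I. s \<noteq> s0 \<and> (\<sigma> s i = \<sigma> s0 i \<and> \<sigma> s j = \<sigma> s0 j \<or> \<sigma> s i = \<sigma> s0 j \<and> \<sigma> s j = \<sigma> s0 i)"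
proof -
  define k where "k x = (if x \<in> {i, j} then 0 else 1 :: nat)" for x
  define l where "l y = (if y \<in> {\<sigma> s0 i, \<sigma> s0 j} then 0 else 1 :: nat)" for y
  let ?A = "{s\<in>I. \<forall>x\<in>R. l (\<sigma> s x) = k x}"
  have s0A: "s0 \<in> ?A" using s0 ij inj[OF s0] by (auto simp: k_def l_def)
  have "(\<Sum>s\<in>?A. c s) = 0" by (rule colour) (use r in \<open>simp add: k_def\<close>)
  then have "?A \<noteq> {s0}" using nz[OF s0] by auto
  then obtain s where s: "s \<in> ?A" "s \<noteq> s0" using s0A by blast
  then have "l (\<sigma> s i) = 0" "l (\<sigma> s j) = 0" using ij by (auto simp: k_def)
  then have "\<sigma> s i \<in> {\<sigma> s0 i, \<sigma> s0 j}" "\<sigma> s j \<in> {\<sigma> s0 i, \<sigma> s0 j}" by (auto simp: l_def split: if_splits)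
  moreover have "\<sigma> s i \<noteq> \<sigma> s j" using inj[of s i j] s ij by auto
  ultimately show ?thesis using s by (intro bexI[of _ s]) auto
qed

text \<open>Fix \<open>s0\<close>. Each row \<open>i\<close> has exactly one other member \<open>p i\<close> agreeing with \<open>s0\<close> there. Rows
  with different partners must be swapped by some member, but a row has only three choices.\<close>
lemma card_R_two:
  assumes r: "r = 2" and ne: "R \<noteq> {}"
  shows "card R = 3"
proof (rule ccontr)
  assume "card R \<noteq> 3"
  then have big: "4 \<le> card R" using card_R_ge[OF ne] r by simp
  obtain s0 where s0: "s0 \<in> I" using I_nonempty by blast
  have "\<exists>s\<in>I. s \<noteq> s0 \<and> (\<forall>t\<in>I. \<sigma> t i = \<sigma> s0 i \<longrightarrow> t = s0 \<or> t = s) \<and> \<sigma> s i = \<sigma> s0 i" if i: "i \<in> R" for i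
  proof -
    have "card {s\<in>I. \<sigma> s i = \<sigma> s0 i} = 2" using part[OF i s0] r by (simp add: fact_numeral)
    then obtain x y where xy: "{s\<in>I. \<sigma> s i = \<sigma> s0 i} = {x, y}" "x \<noteq> y" by (auto simp: card_2_iff)
    then have "s0 \<in> {x, y}" using s0 by blast
    then show ?thesis
    proof
      assume "s0 = x"
      then show ?thesis using xy by (intro bexI[of _ y]) blast+
    next
      assume "s0 \<in> {y}"
      then show ?thesis using xy by (intro bexI[of _ x]) blast+
    qed
  qed
  then obtain p where p: "\<And>i. i \<in> R \<Longrightarrow> p i \<in> I" "\<And>i. i \<in> R \<Longrightarrow> p i \<noteq> s0"
    "\<And>i. i \<in> R \<Longrightarrow> \<sigma> (p i) i = \<sigma> s0 i"
    "\<And>i t. i \<in> R \<Longrightarrow> t \<in> I \<Longrightarrow> \<sigma> t i = \<sigma> s0 i \<Longrightarrow> t = s0 \<or> t = p i"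
    by metis
  let ?J = "\<lambda>i. (\<lambda>s. \<sigma> s i) ` I"
  have finJ: "finite (?J i)" for i using fin by simp
  have cJ: "card (?J i) = 3" if "i \<in> R" for i using choices[OF that] r by simp
  have swap: "\<sigma> s0 j \<in> ?J i" if ij: "i \<in> R" "j \<in> R" "p i \<noteq> p j" for i j
  proof -
    have "i \<noteq> j" using ij by auto
    then obtain s where s: "s \<in> I" "s \<noteq> s0"
      "\<sigma> s i = \<sigma> s0 i \<and> \<sigma> s j = \<sigma> s0 j \<or> \<sigma> s i = \<sigma> s0 j \<and> \<sigma> s j = \<sigma> s0 i"
      using pair_stable[OF _ s0 ij(1,2)] r by auto
    then have "\<sigma> s i = \<sigma> s0 j" using p(4)[OF ij(1) s(1)] p(4)[OF ij(2) s(1)] ij(3) by auto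
    then show ?thesis using s(1) by (metis imageI)
  qed
  \<comment> \<open>The rows whose partner differs from that of \<open>i\<close>. Their columns
    under \<open>s0\<close> are choices of row \<open>i\<close> other than its own, so there are at
    most two such rows.\<close>
  define N where "N i = {x\<in>R. p x \<noteq> p i}" for i
  have finN: "finite (N i)" for i using fin by (simp add: N_def)
  have N2: "card (N i) \<le> 2" if i: "i \<in> R" for i
  proof -
    have "\<sigma> s0 ` N i \<subseteq> ?J i - {\<sigma> s0 i}"
    proof
      fix y assume "y \<in> \<sigma> s0 ` N i"
      then obtain x where x: "x \<in> R" "p x \<noteq> p i" "y = \<sigma> s0 x" by (auto simp: N_def)
      then show "y \<in> ?J i - {\<sigma> s0 i}" using swap[OF i x(1)] inj[OF s0 x(1) i] by auto
    qed
    then have "card (\<sigma> s0 ` N i) \<le> card (?J i - {\<sigma> s0 i})" using finJ by (intro card_mono) auto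
    moreover have "card (\<sigma> s0 ` N i) = card (N i)"
      by (intro card_image inj_on_subset[OF bij_betw_imp_inj_on[OF bij[OF s0]]]) (auto simp: N_def)
    moreover have "card (?J i - {\<sigma> s0 i}) = 2"
      using cJ[OF i] s0 finJ by (subst card_Diff_singleton) auto
    ultimately show ?thesis by simp
  qed
  obtain i where i: "i \<in> R" using ne by blast
  have "\<exists>j\<in>R. p j \<noteq> p i"
  proof (rule ccontr)
    assume "\<not> ?thesis"
    then have "p i = s0" using p i by (intro ext s0) metis+
    then show False using p(2)[OF i] by simp
  qed
  then obtain j where j: "j \<in> R" "p j \<noteq> p i" by blast
  have union: "N i \<union> N j = R" using j by (auto simp: N_def)
  then have "card R \<le> card (N i) + card (N j)" using card_Un_le by metis
  then have cards: "card R = 4" "card (N i) = 2" "card (N j) = 2" using N2[OF i] N2[OF j(1)] big by auto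
  then have "card (N i \<inter> N j) = 0" using card_Un_Int[OF finN finN, of i j] union by simp
  then have disj: "N i \<inter> N j = {}" using finN by simp
  have "i \<in> N j" using i j by (auto simp: N_def)
  then obtain i' where i': "N j = {i, i'}" "i' \<noteq> i" using cards(3) by (metis card_2_iff insertE insert_commute singletonD)
  have i'R: "i' \<in> R" using i'(1) by (auto simp: N_def)
  \<comment> \<open>The partner of \<open>j\<close> agrees with \<open>s0\<close> exactly on
    \<open>N i\<close>, so it must exchange the two remaining rows \<open>i\<close> and
    \<open>i'\<close>. Row \<open>i\<close> then has four choices, one too many.\<close>
  define s where "s = p j"
  have s: "s \<in> I" "s \<noteq> s0" using p j by (auto simp: s_def)
  have agree: "\<sigma> s x = \<sigma> s0 x \<longleftrightarrow> x \<in> N i" if x: "x \<in> R" for x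
  proof
    assume "\<sigma> s x = \<sigma> s0 x"
    then have "s = p x" using p(4)[OF x s(1)] s(2) by simp
    then have "x \<notin> N j" by (simp add: N_def s_def)
    then show "x \<in> N i" using union x by blast
  next
    assume "x \<in> N i"
    then have "x \<notin> N j" using disj by blast
    then have "p x = s" using x by (simp add: N_def s_def)
    then show "\<sigma> s x = \<sigma> s0 x" using p(3)[OF x] by simp
  qed
  have si: "\<sigma> s i = \<sigma> s0 i'"
  proof -
    have "\<sigma> s i \<in> \<sigma> s0 ` R" using bij[OF s(1)] bij[OF s0] i by (auto simp: bij_betw_def)
    then obtain x where x: "x \<in> R" "\<sigma> s i = \<sigma> s0 x" by blast
    have "i \<notin> N i" by (simp add: N_def)
    then have "x \<noteq> i" using agree[OF i] x by auto
    moreover have "x \<notin> N i"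
    proof
      assume "x \<in> N i"
      then have "\<sigma> s i = \<sigma> s x" using agree[OF x(1)] x by simp
      then show False using inj[OF s(1) i x(1)] \<open>x \<noteq> i\<close> by simp
    qed
    ultimately have "x = i'" using x(1) union i' by auto
    then show ?thesis using x by simp
  qed
  have "\<sigma> s0 ` R \<subseteq> ?J i"
  proof
    fix y assume "y \<in> \<sigma> s0 ` R"
    then obtain x where x: "x \<in> R" "y = \<sigma> s0 x" by blast
    show "y \<in> ?J i"
    proof (cases "x \<in> N i")
      case True
      then show ?thesis using swap[OF i x(1)] x by (simp add: N_def)
    next
      case False
      then have "x = i \<or> x = i'" using x union i' by auto
      then show ?thesis using x si s0 s(1) by (metis imageI)
    qed
  qed
  then have "card (\<sigma> s0 ` R) \<le> 3" using card_mono[OF finJ] cJ[OF i] by metis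
  moreover have "card (\<sigma> s0 ` R) = card R"
    by (intro card_image bij_betw_imp_inj_on[OF bij[OF s0]])
  ultimately show False using big by simp
qed

end

text \<open>For rank at least three, let \<open>T i\<close> consist of the members agreeing with \<open>s0\<close> in row \<open>i\<close>.
  By induction \<open>T i\<close> moves exactly \<open>r\<close> of the rows; a row it fixes has the same \<open>T\<close>. If there were
  two more rows, two moving rows of \<open>T i\<close> would have the same \<open>T\<close>, although \<open>T i\<close> contains all
  permutations of its moving rows.\<close>
lemma card_moving_rows:
  fixes c :: "'s \<Rightarrow> 'a::alg_closed_field"
  assumes "2 \<le> r" "vanishing m n r I c \<mu>" "family m n I c \<mu>" "card I = fact (Suc r)"
  shows "card (moving_rows I \<mu>) = Suc r"
  using assms
proof (induction r arbitrary: I rule: nat_induct_at_least)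
  case base
  obtain \<sigma> where pf: "perm_family 2 I c (moving_rows I \<mu>) (moving_rows I (\<lambda>s i j. \<mu> s j i)) \<sigma>"
    using minimal_family_shape[OF base(1,2) order_refl base(3)] by blast
  then interpret perm_family 2 I c "moving_rows I \<mu>" "moving_rows I (\<lambda>s i j. \<mu> s j i)" \<sigma> .
  have "moving_rows I \<mu> \<noteq> {}"
    using vanishing_all_same_row[of m n 1 I c \<mu>] base(1,2) I_nonempty by (simp add: numeral_2_eq_2)
  then show ?case using card_R_two by simp
next
  case (Suc r)
  note van = Suc.prems(1) and fam = Suc.prems(2) and card = Suc.prems(3)
  define R where "R = moving_rows I \<mu>"
  have r1: "2 \<le> Suc r" using Suc.hyps by simp
  obtain \<sigma> where "perm_family (Suc r) I c R (moving_rows I (\<lambda>s i j. \<mu> s j i)) \<sigma>"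
    using minimal_family_shape[OF van fam r1 card] unfolding R_def by blast
  then interpret P: perm_family "Suc r" I c R "moving_rows I (\<lambda>s i j. \<mu> s j i)" \<sigma> .
  have ne: "R \<noteq> {}"
    unfolding R_def by (rule vanishing_all_same_row[OF van fam P.I_nonempty])
  have fin: "finite I" "finite R" using P.fin by auto
  obtain s0 where s0: "s0 \<in> I" using P.I_nonempty by blast
  define T where "T i = {s\<in>I. \<mu> s i = \<mu> s0 i}" for i
  define M where "M i = moving_rows (T i) \<mu>" for i
  have cT: "card (T i) = fact (Suc r)" if "i \<in> R" for i
    unfolding T_def
    by (rule minimal_row_parts(2)[OF van fam card]) (use that s0 in \<open>auto simp: R_def\<close>)
  have T_van: "vanishing m n r (T i) c \<mu>" if "i \<in> R" for i
    unfolding T_def using that moving_rows_subset[OF fam]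
    by (intro vanishing_pin_row[OF van fin(1) _ family_support[OF fam]]) (auto simp: R_def)
  have T_fam: "family m n (T i) c \<mu>" for i
    by (rule family_subset[OF fam]) (auto simp: T_def)
  have cM: "card (M i) = Suc r" if "i \<in> R" for i
    unfolding M_def by (rule Suc.IH[OF T_van[OF that] T_fam cT[OF that]])
  have finT: "finite (T i)" for i using fin by (simp add: T_def)
  have s0T: "s0 \<in> T i" for i using s0 by (simp add: T_def)
  have MR: "M i \<subset> R" if "i \<in> R" for i
    unfolding M_def T_def R_def by (rule moving_rows_part) (use that in \<open>simp add: R_def\<close>)
  have same: "T x = T i" if ix: "i \<in> R" "x \<in> R" "x \<notin> M i" for i x
  proof -
    have "T i \<subseteq> T x"
    proof
      fix s assume s: "s \<in> T i"
      then have "\<mu> s x = \<mu> s0 x" using not_moving[of x "T i" \<mu> s s0] ix s0T by (simp add: M_def)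
      then show "s \<in> T x" using s by (simp add: T_def)
    qed
    then show ?thesis using cT[OF ix(1)] cT[OF ix(2)] finT by (metis card_subset_eq)
  qed
  have different: "T x \<noteq> T i" if xM: "x \<in> M i" for i x
  proof
    assume eq: "T x = T i"
    obtain s s' where "s \<in> T i" "s' \<in> T i" "\<mu> s x \<noteq> \<mu> s' x"
      using xM unfolding M_def by (rule moving_rowsE)
    then have "s \<in> T x" "s' \<in> T x" "\<mu> s x \<noteq> \<mu> s' x" using eq by auto
    then show False by (simp add: T_def)
  qed
  have "card R \<le> Suc (Suc r)"
  proof (rule ccontr)
    assume "\<not> ?thesis"
    then have big: "Suc (Suc (Suc r)) \<le> card R" by simp
    obtain i where i: "i \<in> R" using ne by blast
    have "M i \<noteq> {}" using cM[OF i] by auto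
    then obtain x where x: "x \<in> M i" by blast
    then have xR: "x \<in> R" using MR[OF i] by blast
    have xM: "x \<notin> M x" using different[of x x] by blast
    have "card (R - M x) = card R - card (M x)"
      using MR[OF xR] fin finite_subset by (intro card_Diff_subset) auto
    then have "2 \<le> card (R - M x)" using cM[OF xR] big by simp
    then have "R - M x \<noteq> {x}" by auto
    then obtain y where y: "y \<in> R" "y \<notin> M x" "y \<noteq> x" using xM xR by blast
    have Txy: "T y = T x" by (rule same[OF xR y(1,2)])
    have yM: "y \<in> M i"
    proof (rule ccontr)
      assume "y \<notin> M i"
      then have "T y = T i" by (rule same[OF i y(1)])
      then show False using Txy different[OF x] by simp
    qed
    \<comment> \<open>\<open>M i\<close> has \<open>r + 1\<close>, hence at least three, rows, so
      there is a third row \<open>z\<close> with which \<open>y\<close> can be exchanged while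
      \<open>x\<close> stays fixed.\<close>
    have "\<not> M i \<subseteq> {x, y}"
    proof
      assume "M i \<subseteq> {x, y}"
      then have "card (M i) \<le> card {x, y}" by (intro card_mono) auto
      then show False using cM[OF i] Suc.hyps y(3) by simp
    qed
    then obtain z where z: "z \<in> M i" "z \<noteq> x" "z \<noteq> y" by blast
    obtain U q q' \<tau> where pf: "perm_family r (T i) c (M i) (moving_rows (T i) (\<lambda>s i j. \<mu> s j i)) \<tau>"
      and shape: "\<forall>s\<in>T i. \<mu> s = (\<lambda>k j. U k j + (if k \<in> M i \<and> j = \<tau> s k then q k else (0::nat)))"
      and q: "\<forall>k\<in>M i. 0 < q k"
      using minimal_family_shape[OF T_van[OF i] T_fam Suc.hyps cT[OF i]] unfolding M_def by blast
    interpret Q: perm_family r "T i" c "M i" "moving_rows (T i) (\<lambda>s i j. \<mu> s j i)" \<tau> by (rule pf)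
    \<comment> \<open>The member realising \<open>f\<close> agrees with \<open>s0\<close> in row
      \<open>x\<close> but not in row \<open>y\<close>, which separates \<open>T x\<close> from
      \<open>T y\<close>.\<close>
    define f where "f = \<tau> s0 \<circ> Transposition.transpose y z"
    have "Transposition.transpose y z permutes M i" using yM z by (intro permutes_swap_id)
    then have "bij_betw f (M i) (moving_rows (T i) (\<lambda>s i j. \<mu> s j i))"
      unfolding f_def by (rule bij_betw_trans[OF permutes_imp_bij Q.bij[OF s0T]])
    then obtain s where s: "s \<in> T i" "\<forall>k\<in>M i. \<tau> s k = f k"
      using Q.all_bijections[OF cM[OF i]] by blast
    have "\<tau> s x = \<tau> s0 x" using s x z y by (simp add: f_def)
    then have "\<mu> s x = \<mu> s0 x" using shape[rule_format, OF s(1)] shape[rule_format, OF s0T] by simp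
    then have "s \<in> T x" using s(1) by (simp add: T_def)
    moreover have "\<mu> s y \<noteq> \<mu> s0 y"
    proof
      assume "\<mu> s y = \<mu> s0 y"
      then have "\<mu> s y (\<tau> s y) = \<mu> s0 y (\<tau> s y)" by simp
      then have "\<tau> s y = \<tau> s0 y"
        using shape[rule_format, OF s(1)] shape[rule_format, OF s0T] yM bspec[OF q yM]
        by (simp split: if_splits)
      moreover have "\<tau> s y = \<tau> s0 z" using s(2) yM by (simp add: f_def)
      ultimately show False using Q.inj[OF s0T yM z(1)] z(3) by simp
    qed
    then have "s \<notin> T y" by (simp add: T_def)
    ultimately show False using Txy by simp
  qed
  then show ?case using P.card_R_ge[OF ne] by (simp add: R_def)
qed

context perm_family
begin

text \<open>Build \<open>p\<close> from transpositions. Each intermediate permutation is realised by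
  some member, because all bijections occur, and each step changes the sign of the
  coefficient.\<close>

lemma sign_of_permutation:
  assumes card_R: "card R = Suc r" and e: "bij_betw e K R" and s0: "s0 \<in> I" and p: "p permutes K"
    and s: "s \<in> I" "\<And>k. k \<in> K \<Longrightarrow> \<sigma> s (e k) = \<sigma> s0 (e (p k))"
  shows "c s = of_int (sign p) * c s0"
proof -
  have fin_K: "finite K" using bij_betw_finite[OF e] fin(2) by simp
  have eR: "e k \<in> R" if "k \<in> K" for k using bij_betwE[OF e] that by blast
  have e_inj: "e k = e k' \<longleftrightarrow> k = k'" if "k \<in> K" "k' \<in> K" for k k'
    using bij_betw_imp_inj_on[OF e] that by (rule inj_on_eq_iff)
  have onto: "\<exists>k\<in>K. i = e k" if "i \<in> R" for i
    using bij_betw_imp_surj_on[OF e] that by blast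
  show ?thesis
    using fin_K p s
  proof (induction p arbitrary: s rule: permutes_rev_induct)
    case id
    have "s = s0"
    proof (rule ext[OF id(1) s0])
      fix i assume "i \<in> R"
      then obtain k where "k \<in> K" "i = e k" using onto by blast
      then show "\<sigma> s i = \<sigma> s0 i" using id(2) by simp
    qed
    then show ?case by simp
  next
    case (swap a b p)
    note ab = swap.hyps(1-3) and p = swap.hyps(4)
    have "bij_betw (\<sigma> s0 \<circ> (e \<circ> (p \<circ> inv_into K e))) R R'"
      by (intro bij_betw_trans[of _ _ K] bij_betw_trans[of _ _ R] bij_betw_inv_into[OF e]
          permutes_imp_bij[OF p] e bij[OF s0])
    then obtain t where t: "t \<in> I" "\<And>i. i \<in> R \<Longrightarrow> \<sigma> t i = \<sigma> s0 (e (p (inv_into K e i)))"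
      using all_bijections[OF card_R] by (metis comp_apply)
    have te: "\<sigma> t (e k) = \<sigma> s0 (e (p k))" if "k \<in> K" for k
      using t(2)[OF eR[OF that]] bij_betw_inv_into_left[OF e that] by simp
    have "c s = - c t"
    proof (rule swap_sign[OF card_R t(1) swap.prems(1) eR[OF ab(1)] eR[OF ab(2)]])
      show "e a \<noteq> e b" using e_inj ab by simp
      show "\<sigma> s (e a) = \<sigma> t (e b)" "\<sigma> s (e b) = \<sigma> t (e a)"
        using swap.prems(2) ab te by simp_all
      fix i assume i: "i \<in> R" "i \<noteq> e a" "i \<noteq> e b"
      then obtain k where k: "k \<in> K" "i = e k" using onto by blast
      then have "k \<noteq> a" "k \<noteq> b" using i by auto
      then show "\<sigma> s i = \<sigma> t i" using swap.prems(2)[OF k(1)] te[OF k(1)] k(2) by simp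
    qed
    moreover have "c t = of_int (sign p) * c s0" by (rule swap.IH[OF t(1) te])
    moreover have "sign (p \<circ> Transposition.transpose a b) = - sign p"
      using ab permutes_imp_permutation[OF fin_K p]
      by (simp add: sign_compose permutation_swap_id sign_swap_id)
    ultimately show ?case by (simp add: comp_def)
  qed
qed

end

section \<open>Polynomials in the matrix entries\<close>

lemma submatrix_lessThan:
  assumes "A \<in> carrier_mat m n" "r \<le> m" "r \<le> n"
  shows "submatrix A {..<r} {..<r} = mat r r (\<lambda>(i, j). A $$ (i, j))"
proof -
  have pick: "pick {..<r} i = i" if "i < r" for i
  proof -
    have "{a \<in> {..<r}. a < i} = {..<i}" using that by auto
    then show ?thesis using pick_card_in_set[of i "{..<r}"] that by simp
  qed
  have "{i. i < m \<and> i < r} = {..<r}" "{i. i < n \<and> i < r} = {..<r}" using assms by auto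
  then show ?thesis
    using assms(1) by (intro eq_matI) (auto simp: submatrix_def pick)
qed

text \<open>Each further inner index adds a matrix of rank at most one.\<close>

lemma mrank_product_le: "mrank m (mat m n (\<lambda>(i, j). mmul r B C i j)) \<le> r"
proof (induction r)
  case 0
  have "mat m n (\<lambda>(i, j). mmul 0 B C i j) = 0\<^sub>m m n" by (auto simp: mmul_def)
  then show ?case by (simp add: mrank_def vec_space.rank_0I)
next
  case (Suc r)
  let ?A = "mat m n (\<lambda>(i, j). mmul r B C i j)" and ?D = "mat m n (\<lambda>(i, j). B i r * C r j)"
  have "mat m n (\<lambda>(i, j). mmul (Suc r) B C i j) = ?A + ?D"
    by (intro eq_matI) (auto simp: mmul_def)
  moreover have "vec_space.rank m (?A + ?D) \<le> vec_space.rank m ?A + vec_space.rank m ?D"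
    by (rule vec_space.rank_subadditive) auto
  moreover have "vec_space.rank m ?D \<le> 1"
    by (rule vec_space.rank_le_1_product_entries[where f = "\<lambda>i. B i r" and g = "\<lambda>j. C r j"]) auto
  ultimately show ?case using Suc by (simp add: mrank_def)
qed

lemma mrank_product:
  assumes "r \<le> m" "r \<le> n" "det (mat r r (\<lambda>(i, j). mmul r B C i j)) \<noteq> 0"
  shows "mrank m (mat m n (\<lambda>(i, j). mmul r B C i j)) = r"
proof (rule antisym[OF mrank_product_le])
  let ?A = "mat m n (\<lambda>(i, j). mmul r B C i j)"
  have "submatrix ?A {..<r} {..<r} = mat r r (\<lambda>(i, j). mmul r B C i j)"
    using submatrix_lessThan[of ?A m n r] assms(1,2) by (auto intro!: eq_matI)
  then have "card {j. j < n \<and> j \<in> {..<r}} \<le> vec_space.rank m ?A"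
    using assms(3) by (intro vec_space.rank_gt_minor[where I = "{..<r}"]) auto
  moreover have "{j. j < n \<and> j \<in> {..<r}} = {..<r}" using assms(2) by auto
  ultimately show "r \<le> mrank m ?A" by (simp add: mrank_def)
qed

section \<open>From polynomials to families of exponent matrices\<close>

definition exponents :: "((nat \<times> nat) \<Rightarrow>\<^sub>0 nat) \<Rightarrow> nat \<Rightarrow> nat \<Rightarrow> nat" where
  "exponents mo = (\<lambda>i j. Poly_Mapping.lookup mo (i, j))"

lemma in_varsD: "in_vars m n f \<Longrightarrow> mo \<in> Poly_Mapping.keys f \<Longrightarrow> Poly_Mapping.keys mo \<subseteq> {..<m} \<times> {..<n}"
  unfolding in_vars_def by (rule subsetI) (simp add: mem_Times_iff)

lemma mpoly_eval_eq:
  assumes "in_vars m n f"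
  shows "mpoly_eval f (mat m n (\<lambda>(i, j). X i j))
    = (\<Sum>mo\<in>Poly_Mapping.keys f. Poly_Mapping.lookup f mo * monev m n (exponents mo) X)"
  unfolding mpoly_eval_def
proof (intro sum.cong refl arg_cong2[where f = "(*)"])
  fix mo assume "mo \<in> Poly_Mapping.keys f"
  note sub = in_varsD[OF assms this]
  let ?A = "mat m n (\<lambda>(i, j). X i j)"
  have "(\<Prod>v\<in>Poly_Mapping.keys mo. ?A $$ v ^ Poly_Mapping.lookup mo v)
      = (\<Prod>v\<in>{..<m} \<times> {..<n}. ?A $$ v ^ Poly_Mapping.lookup mo v)"
    by (intro prod.mono_neutral_left sub) (auto simp: in_keys_iff)
  also have "\<dots> = (\<Prod>i<m. \<Prod>j<n. X i j ^ Poly_Mapping.lookup mo (i, j))"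
    unfolding prod.cartesian_product by (intro prod.cong) auto
  finally show "(\<Prod>v\<in>Poly_Mapping.keys mo. ?A $$ v ^ Poly_Mapping.lookup mo v) = monev m n (exponents mo) X"
    by (simp add: monev_def rmon_def exponents_def)
qed

lemma family_keys:
  assumes "in_vars m n f"
  shows "family m n (Poly_Mapping.keys f) (Poly_Mapping.lookup f) exponents"
proof -
  have "inj_on exponents (Poly_Mapping.keys f)"
  proof
    fix a b assume "exponents a = exponents b"
    then have "Poly_Mapping.lookup a v = Poly_Mapping.lookup b v" for v
      by (cases v) (metis exponents_def)
    then show "a = b" by (rule poly_mapping_eqI)
  qed
  moreover have "exponents mo i j = 0" if "mo \<in> Poly_Mapping.keys f" "m \<le> i \<or> n \<le> j" for mo i j
    using in_varsD[OF assms that(1)] that(2) by (auto simp: exponents_def in_keys_iff)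
  ultimately show ?thesis by (auto simp: family_def in_keys_iff)
qed

text \<open>Products \<open>B C\<close> have rank exactly \<open>r\<close> unless their leading \<open>r\<close>-minor vanishes.\<close>
lemma vanishing_on_rank:
  fixes f :: "'a::alg_closed_field xpoly"
  assumes r: "r \<le> m" "r \<le> n" and f: "in_vars m n f"
    and zero: "\<forall>A \<in> carrier_mat m n. mrank m A = r \<longrightarrow> mpoly_eval f A = 0"
  shows "vanishing m n r (Poly_Mapping.keys f) (Poly_Mapping.lookup f) exponents"
proof -
  define F where "F B C = (\<Sum>mo\<in>Poly_Mapping.keys f. Poly_Mapping.lookup f mo * monev m n (exponents mo) (mmul r B C))" for B C
  define D :: "_ \<Rightarrow> _ \<Rightarrow> 'a" where "D B C = det (mat r r (\<lambda>(i, j). mmul r B C i j))" for B C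
  have "(\<forall>B C. F B C = 0) \<or> (\<forall>B C. D B C = 0)"
  proof (rule line_poly_mult_eq_0_pair)
    show "line_poly (\<lambda>w. F (\<lambda>i j. w (True, i, j)) (\<lambda>i j. w (False, i, j)))"
      unfolding F_def
      by (intro line_poly_sum line_poly_mult line_poly_monev line_poly_mmul line_poly_const line_poly_var)
    show "line_poly (\<lambda>w. D (\<lambda>i j. w (True, i, j)) (\<lambda>i j. w (False, i, j)))"
      unfolding D_def by (intro line_poly_det line_poly_mmul line_poly_var)
    show "F B C * D B C = 0" for B C
    proof (cases "D B C = 0")
      case False
      then have "mpoly_eval f (mat m n (\<lambda>(i, j). mmul r B C i j)) = 0"
        by (intro zero[rule_format] mrank_product r) (simp_all add: D_def)
      then show ?thesis by (simp add: mpoly_eval_eq[OF f] F_def)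
    qed simp
  qed
  moreover have "\<not> (\<forall>B C. D B C = 0)"
  proof -
    let ?E = "\<lambda>i j. of_bool (i = j) :: 'a"
    have "mat r r (\<lambda>(i, j). mmul r ?E ?E i j) = 1\<^sub>m r"
    proof (rule eq_matI)
      fix i j assume ij: "i < dim_row (1\<^sub>m r :: 'a mat)" "j < dim_col (1\<^sub>m r :: 'a mat)"
      have "mmul r ?E ?E i j = (\<Sum>k<r. if k = i then ?E i j else 0)"
        unfolding mmul_def by (intro sum.cong) auto
      then show "mat r r (\<lambda>(i, j). mmul r ?E ?E i j) $$ (i, j) = 1\<^sub>m r $$ (i, j)"
        using ij by simp
    qed auto
    then have "D ?E ?E = 1" by (simp add: D_def)
    then show ?thesis by (metis zero_neq_one)
  qed
  ultimately show ?thesis by (simp add: vanishing_def F_def)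
qed

section \<open>Powers of minors by the characteristic exponent\<close>

lemma CHAR_xpoly: "CHAR('a::comm_ring_1 xpoly) = CHAR('a)"
proof (rule CHAR_eqI)
  have *: "(of_nat k :: 'a xpoly) = 0 \<longleftrightarrow> (of_nat k :: 'a) = 0" for k
    unfolding single_of_nat[symmetric] by (metis lookup_single_eq lookup_zero single_zero)
  show "of_nat CHAR('a) = (0 :: 'a xpoly)" unfolding * by simp
  show "CHAR('a) dvd k" if "of_nat k = (0 :: 'a xpoly)" for k
    using that unfolding * by (simp add: of_nat_eq_0_iff_char_dvd)
qed

lemma xpoly_sum_single: "(f :: 'a::comm_ring_1 xpoly) = (\<Sum>mo\<in>Poly_Mapping.keys f. Poly_Mapping.single mo (Poly_Mapping.lookup f mo))"
proof (rule poly_mapping_eqI)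
  fix k
  have "(\<Sum>mo\<in>Poly_Mapping.keys f. Poly_Mapping.lookup (Poly_Mapping.single mo (Poly_Mapping.lookup f mo)) k)
      = (\<Sum>mo\<in>Poly_Mapping.keys f. if mo = k then Poly_Mapping.lookup f k else 0)"
    by (intro sum.cong) (auto simp: lookup_single)
  then show "Poly_Mapping.lookup f k
      = Poly_Mapping.lookup (\<Sum>mo\<in>Poly_Mapping.keys f. Poly_Mapping.single mo (Poly_Mapping.lookup f mo)) k"
    by (simp add: lookup_sum in_keys_iff)
qed

lemma prod_single:
  "(\<Prod>k\<in>K. Poly_Mapping.single (v k) (1 :: 'a::comm_ring_1)) = Poly_Mapping.single (\<Sum>k\<in>K. v k :: (nat \<times> nat) \<Rightarrow>\<^sub>0 nat) 1"
  by (induction K rule: infinite_finite_induct) (simp_all add: mult_single)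

lemma mvar_power: "(mvar i j :: 'a::comm_ring_1 xpoly) ^ q = Poly_Mapping.single (Poly_Mapping.single (i, j) q) 1"
  by (induction q) (simp_all add: mvar_def mult_single single_add[symmetric])

text \<open>In characteristic 0 the exponent \<open>Q\<close> is 1; otherwise this is iterated
  Frobenius in the polynomial ring, which has the same characteristic.\<close>

lemma xpoly_sum_char_power:
  fixes g :: "'i \<Rightarrow> 'a::field xpoly"
  assumes Q: "Q = char_exp TYPE('a) ^ e"
  shows "(\<Sum>a\<in>A. g a) ^ Q = (\<Sum>a\<in>A. g a ^ Q)"
proof (cases "CHAR('a) = 0")
  case True
  then show ?thesis using Q by (simp add: char_exp_def)
next
  case False
  then have "prime CHAR('a xpoly)" unfolding CHAR_xpoly by (intro prime_CHAR_semidom) simp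
  moreover have "Q = CHAR('a xpoly) ^ e" using Q False by (simp add: char_exp_def CHAR_xpoly)
  ultimately show ?thesis by (rule freshmans_dream_sum')
qed

lemma minor_poly_char_power:
  fixes Q :: nat
  assumes "Q = char_exp TYPE('a::field) ^ e"
  shows "(minor_poly is js :: 'a xpoly) ^ Q = (\<Sum>\<pi> \<in> {\<pi>. \<pi> permutes {..<length is}}.
      Poly_Mapping.single (\<Sum>k<length is. Poly_Mapping.single (is ! k, js ! \<pi> k) Q) (of_int (sign \<pi>)))"
proof -
  let ?P = "{\<pi>. \<pi> permutes {..<length is}}"
  note freshman = xpoly_sum_char_power[OF assms]
  have Q0: "0 < Q" using assms by (simp add: char_exp_def)
  \<comment> \<open>Applying Frobenius to 1 + (-1) = 0 gives (-1)^Q = -1 uniformly, including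
    characteristic 2; so signs survive the power.\<close>
  have "(\<Sum>b\<in>UNIV. if b then 1 else - 1 :: 'a xpoly) ^ Q = (\<Sum>b\<in>UNIV. (if b then 1 else - 1) ^ Q)"
    by (rule freshman)
  then have minus: "(- 1 :: 'a xpoly) ^ Q = - 1"
    using Q0 by (simp add: UNIV_bool eq_neg_iff_add_eq_0 zero_power)
  have "(minor_poly is js :: 'a xpoly) ^ Q
      = (\<Sum>\<pi>\<in>?P. (of_int (sign \<pi>) * (\<Prod>k<length is. mvar (is ! k) (js ! \<pi> k))) ^ Q)"
    unfolding minor_poly_def by (rule freshman)
  also have "\<dots> = (\<Sum>\<pi>\<in>?P.
      Poly_Mapping.single (\<Sum>k<length is. Poly_Mapping.single (is ! k, js ! \<pi> k) Q) (of_int (sign \<pi>)))"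
  proof (intro sum.cong refl)
    fix \<pi> :: "nat \<Rightarrow> nat"
    have "(of_int (sign \<pi>) :: 'a xpoly) ^ Q = of_int (sign \<pi>)"
      using minus by (cases rule: sign_cases[of \<pi>]) simp_all
    then show "(of_int (sign \<pi>) * (\<Prod>k<length is. mvar (is ! k) (js ! \<pi> k)) :: 'a xpoly) ^ Q
        = Poly_Mapping.single (\<Sum>k<length is. Poly_Mapping.single (is ! k, js ! \<pi> k) Q) (of_int (sign \<pi>))"
      by (simp add: power_mult_distrib prod_power_distrib mvar_power prod_single mult_single
          flip: single_of_int)
  qed
  finally show ?thesis .
qed

lemma minimal_xpoly_shape:
  fixes f :: "'a::alg_closed_field xpoly"
  assumes r: "2 \<le> r" and f: "in_vars m n f"
    and van: "vanishing m n r (Poly_Mapping.keys f) (Poly_Mapping.lookup f) exponents"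
    and card: "card (Poly_Mapping.keys f) = fact (Suc r)"
  shows "\<exists>c mo is js e. c \<noteq> 0 \<and> length is = Suc r \<and> length js = Suc r \<and> distinct is \<and> distinct js
    \<and> set is \<subseteq> {..<m} \<and> set js \<subseteq> {..<n}
    \<and> f = Poly_Mapping.single mo c * minor_poly is js ^ (char_exp TYPE('a) ^ e)"
proof -
  let ?I = "Poly_Mapping.keys f"
  note fam = family_keys[OF f]
  define R where "R = moving_rows ?I exponents"
  define R' where "R' = moving_rows ?I (\<lambda>s i j. exponents s j i)"
  obtain U q q' \<sigma> where pf: "perm_family r ?I (Poly_Mapping.lookup f) R R' \<sigma>"
    and shape: "\<And>s. s \<in> ?I \<Longrightarrow> exponents s = (\<lambda>i j. U i j + (if i \<in> R \<and> j = \<sigma> s i then q i else 0))"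
    and q: "\<And>i. i \<in> R \<Longrightarrow> \<exists>e. q i = char_exp TYPE('a) ^ e" "\<And>i s. i \<in> R \<Longrightarrow> s \<in> ?I \<Longrightarrow> q i = q' (\<sigma> s i)"
    using minimal_family_shape[OF van fam r card] unfolding R_def R'_def by blast
  interpret perm_family r ?I "Poly_Mapping.lookup f" R R' \<sigma> by (rule pf)
  have card_R: "card R = Suc r" unfolding R_def by (rule card_moving_rows[OF r van fam card])
  define xs where "xs = sorted_list_of_set R"
  define ys where "ys = sorted_list_of_set R'"
  have xs: "length xs = Suc r" "distinct xs" "set xs = R"
    using fin(2) card_R by (simp_all add: xs_def)
  have ys: "length ys = Suc r" "distinct ys" "set ys = R'"
    using finite_R' card_R card_R' by (simp_all add: ys_def)
  have bij_xs: "bij_betw ((!) xs) {..<Suc r} R"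
    using bij_betw_nth[OF xs(2)] xs by (simp add: lessThan_atLeast0)
  have bij_ys: "bij_betw ((!) ys) {..<Suc r} R'"
    using bij_betw_nth[OF ys(2)] ys by (simp add: lessThan_atLeast0)
  define i0 where "i0 = xs ! 0"
  have i0: "i0 \<in> R" using xs by (metis i0_def nth_mem zero_less_Suc)
  define Q where "Q = q i0"
  obtain e where e: "Q = char_exp TYPE('a) ^ e" using q(1)[OF i0] by (auto simp: Q_def)
  \<comment> \<open>Each row takes every column of \<open>R'\<close>, as both counts are
    \<open>r + 1\<close>. Any row thus shares a column with \<open>i0\<close>, and the exponent
    depends only on the column.\<close>
  have qQ: "q i = Q" if "i \<in> R" for i
  proof -
    have full: "(\<lambda>s. \<sigma> s i) ` ?I = R'" if "i \<in> R" for i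
      using choices_subset[OF that] choices[OF that] card_R card_R' finite_R' by (metis card_subset_eq)
    obtain s0 where s0: "s0 \<in> ?I" using I_nonempty by blast
    have "\<sigma> s0 i \<in> (\<lambda>s. \<sigma> s i0) ` ?I" using full[OF that] full[OF i0] s0 by blast
    then obtain s where "s \<in> ?I" "\<sigma> s0 i = \<sigma> s i0" by blast
    then show ?thesis using q(2)[OF that s0] q(2)[OF i0] by (simp add: Q_def)
  qed
  let ?P = "{\<pi>. \<pi> permutes {..<Suc r}}"
  have "\<exists>s\<in>?I. \<forall>k<Suc r. \<sigma> s (xs ! k) = ys ! \<pi> k" if "\<pi> \<in> ?P" for \<pi>
  proof -
    have "bij_betw ((!) ys \<circ> (\<pi> \<circ> inv_into {..<Suc r} ((!) xs))) R R'"
      using that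
      by (intro bij_betw_trans[of _ _ "{..<Suc r}"] bij_betw_inv_into[OF bij_xs] bij_ys permutes_imp_bij) simp
    then obtain s where "s \<in> ?I" "\<And>i. i \<in> R \<Longrightarrow> \<sigma> s i = ys ! \<pi> (inv_into {..<Suc r} ((!) xs) i)"
      using all_bijections[OF card_R] by (metis comp_apply)
    then show ?thesis
      using bij_betw_inv_into_left[OF bij_xs] bij_betwE[OF bij_xs] by (intro bexI[of _ s]) auto
  qed
  then obtain S where S: "\<And>\<pi>. \<pi> \<in> ?P \<Longrightarrow> S \<pi> \<in> ?I"
    "\<And>\<pi> k. \<pi> \<in> ?P \<Longrightarrow> k < Suc r \<Longrightarrow> \<sigma> (S \<pi>) (xs ! k) = ys ! \<pi> k"
    by metis
  have inj_S: "inj_on S ?P"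
  proof
    fix \<pi> \<rho> assume \<pi>: "\<pi> \<in> ?P" and \<rho>: "\<rho> \<in> ?P" and eq: "S \<pi> = S \<rho>"
    show "\<pi> = \<rho>"
    proof
      fix k
      show "\<pi> k = \<rho> k"
      proof (cases "k < Suc r")
        case True
        then have "ys ! \<pi> k = ys ! \<rho> k" using S(2)[OF \<pi>] S(2)[OF \<rho>] eq by metis
        moreover have "\<pi> k < Suc r" "\<rho> k < Suc r"
          using True \<pi> \<rho> by (auto simp: permutes_in_image simp flip: lessThan_iff)
        ultimately show ?thesis using ys by (simp add: nth_eq_iff_index_eq)
      next
        case False
        then show ?thesis using \<pi> \<rho> by (simp add: permutes_not_in)
      qed
    qed
  qed
  have image_S: "S ` ?P = ?I"
  proof (rule card_subset_eq)
    show "card (S ` ?P) = card ?I"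
      using card_image[OF inj_S] card_permutations[of "{..<Suc r}" "Suc r"] card by simp
  qed (use S(1) in auto)
  define D where "D \<pi> = (\<Sum>k<Suc r. Poly_Mapping.single (xs ! k, ys ! \<pi> k) Q)" for \<pi>
  have lookup_D: "Poly_Mapping.lookup (D \<pi>) (i, j) = (if i \<in> R \<and> j = \<sigma> (S \<pi>) i then Q else 0)"
    if \<pi>: "\<pi> \<in> ?P" for \<pi> i j
  proof (cases "i \<in> R")
    case True
    then obtain l where l: "l < Suc r" "i = xs ! l" using xs by (metis in_set_conv_nth)
    have "Poly_Mapping.lookup (D \<pi>) (i, j) = (\<Sum>k<Suc r. if k = l then (if j = ys ! \<pi> l then Q else 0) else 0)"
      unfolding D_def lookup_sum
      by (intro sum.cong) (use l xs in \<open>auto simp: lookup_single nth_eq_iff_index_eq when_def\<close>)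
    then show ?thesis using l True S(2)[OF \<pi> l(1)] by simp
  next
    case False
    then have "xs ! k \<noteq> i" if "k < Suc r" for k using that xs by (metis nth_mem)
    then have "Poly_Mapping.lookup (D \<pi>) (i, j) = 0"
      unfolding D_def lookup_sum by (intro sum.neutral) (auto simp: lookup_single when_def)
    then show ?thesis using False by simp
  qed
  have idP: "id \<in> ?P" by (simp add: permutes_id)
  \<comment> \<open>The common monomial is read off from one term; the truncated subtraction is
    exact because \<open>D id\<close> divides \<open>S id\<close>.\<close>
  define mo where "mo = S id - D id"
  have lookup_mo: "Poly_Mapping.lookup mo (i, j) = U i j" for i j
    using fun_cong[OF fun_cong[OF shape[OF S(1)[OF idP]], of i], of j] lookup_D[OF idP, of i j]
    by (simp add: mo_def lookup_minus exponents_def qQ split: if_splits)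
  have S_eq: "S \<pi> = mo + D \<pi>" if \<pi>: "\<pi> \<in> ?P" for \<pi>
  proof (rule poly_mapping_eqI)
    fix v :: "nat \<times> nat"
    obtain i j where v: "v = (i, j)" by (cases v)
    show "Poly_Mapping.lookup (S \<pi>) v = Poly_Mapping.lookup (mo + D \<pi>) v"
      using fun_cong[OF fun_cong[OF shape[OF S(1)[OF \<pi>]], of i], of j] lookup_D[OF \<pi>, of i j]
      by (simp add: v lookup_add lookup_mo exponents_def qQ split: if_splits)
  qed
  define c where "c = Poly_Mapping.lookup f (S id)"
  have sign: "Poly_Mapping.lookup f (S \<pi>) = of_int (sign \<pi>) * c" if \<pi>: "\<pi> \<in> ?P" for \<pi>
    unfolding c_def
  proof (rule sign_of_permutation[OF card_R bij_xs S(1)[OF idP]])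
    show "\<sigma> (S \<pi>) (xs ! k) = \<sigma> (S id) (xs ! \<pi> k)" if "k \<in> {..<Suc r}" for k
    proof -
      have "\<pi> k < Suc r" using that \<pi> by (auto simp: permutes_in_image simp flip: lessThan_iff)
      then show ?thesis using S(2)[OF \<pi>, of k] S(2)[OF idP, of "\<pi> k"] that by simp
    qed
  qed (use \<pi> S(1) in auto)
  have "f = (\<Sum>s\<in>S ` ?P. Poly_Mapping.single s (Poly_Mapping.lookup f s))"
    unfolding image_S by (rule xpoly_sum_single)
  also have "\<dots> = (\<Sum>\<pi>\<in>?P. Poly_Mapping.single (S \<pi>) (Poly_Mapping.lookup f (S \<pi>)))"
    by (simp add: sum.reindex[OF inj_S])
  also have "\<dots> = (\<Sum>\<pi>\<in>?P. Poly_Mapping.single mo c * Poly_Mapping.single (D \<pi>) (of_int (sign \<pi>)))"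
  proof (rule sum.cong[OF refl])
    fix \<pi> assume \<pi>: "\<pi> \<in> ?P"
    show "Poly_Mapping.single (S \<pi>) (Poly_Mapping.lookup f (S \<pi>))
        = Poly_Mapping.single mo c * Poly_Mapping.single (D \<pi>) (of_int (sign \<pi>))"
      unfolding sign[OF \<pi>] unfolding S_eq[OF \<pi>] by (simp add: mult_single mult.commute)
  qed
  also have "\<dots> = Poly_Mapping.single mo c * minor_poly xs ys ^ (char_exp TYPE('a) ^ e)"
    unfolding e[symmetric] minor_poly_char_power[OF e] xs(1) D_def sum_distrib_left ..
  finally have "f = Poly_Mapping.single mo c * minor_poly xs ys ^ (char_exp TYPE('a) ^ e)" .
  moreover have "c \<noteq> 0" unfolding c_def by (rule nz[OF S(1)[OF idP]])
  moreover have "set xs \<subseteq> {..<m}" "set ys \<subseteq> {..<n}"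
    unfolding xs ys R_def R'_def
    using moving_rows_subset[OF fam] moving_rows_subset[OF family_transpose[OF fam]] by auto
  ultimately show ?thesis using xs ys by blast
qed

theorem theorem3p1:
  fixes m n r :: nat
  assumes "r \<le> m" and "r \<le> n"
  shows "(\<forall>f :: 'a::alg_closed_field xpoly.
            in_vars m n f
          \<and> (\<forall>A \<in> carrier_mat m n. mrank m A = r \<longrightarrow> mpoly_eval f A = 0)
          \<and> num_terms f < fact (r + 1)
          \<longrightarrow> f = 0)
       \<and> (2 \<le> r \<longrightarrow>
          (\<forall>f :: 'a xpoly.
            in_vars m n f
          \<and> (\<forall>A \<in> carrier_mat m n. mrank m A = r \<longrightarrow> mpoly_eval f A = 0)
          \<and> num_terms f = fact (r + 1)
          \<longrightarrow> (\<exists>c mo is js e. c \<noteq> 0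
                 \<and> length is = r + 1 \<and> length js = r + 1
                 \<and> distinct is \<and> distinct js
                 \<and> set is \<subseteq> {..<m} \<and> set js \<subseteq> {..<n}
                 \<and> f = Poly_Mapping.single mo c * minor_poly is js ^ (char_exp TYPE('a) ^ e))))"
proof (intro conjI allI impI; elim conjE)
  fix f :: "'a xpoly"
  assume f: "in_vars m n f" and zero: "\<forall>A \<in> carrier_mat m n. mrank m A = r \<longrightarrow> mpoly_eval f A = 0"
  note van = vanishing_on_rank[OF assms f zero]
  show "f = 0" if "num_terms f < fact (r + 1)"
  proof (rule ccontr)
    assume "f \<noteq> 0"
    then have "Poly_Mapping.keys f \<noteq> {}" by simp
    then show False
      using vanishing_card_ge[OF van family_keys[OF f]] that by (simp add: num_terms_def)
  qed
  show "\<exists>c mo is js e. c \<noteq> 0 \<and> length is = r + 1 \<and> length js = r + 1 \<and> distinct is \<and> distinct js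
      \<and> set is \<subseteq> {..<m} \<and> set js \<subseteq> {..<n}
      \<and> f = Poly_Mapping.single mo c * minor_poly is js ^ (char_exp TYPE('a) ^ e)"
    if "2 \<le> r" "num_terms f = fact (r + 1)"
    using minimal_xpoly_shape[OF that(1) f van] that(2) by (simp add: num_terms_def)
qed

end
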